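(* Let $\mathcal L$ be the honeycomb lattice graph, with $\mathbf v_1=\left(\frac32,\frac{\sqrt3}2\right)$ and $\mathbf v_2=\left(\frac32,-\frac{\sqrt3}2\right)$. Let \[ \Lambda_Q=\mathbb Z(2\mathbf v_1)+\mathbb Z(2\mathbf v_2),\qquad \Lambda_{X_3}=\mathbb Z(2\mathbf v_1+2\mathbf v_2)+\mathbb Z(4\mathbf v_1-2\mathbf v_2), \] regarded as groups of translations of $\mathbb R^2$, let $R$ be the half-turn rotation of $\mathbb R^2$ around the origin $(0,0)$, and let $G_{K_4}=\Lambda_Q\rtimes\langle R\rangle$ (resp. $G_T=\Lambda_{X_3}\rtimes\langle R\rangle$) be the group of isometries of $\mathbb R^2$ generated by $R$ together with the translations by vectors in $\Lambda_Q$ (resp. $\Lambda_{X_3}$). Then the four groups $G_{K_4},\Lambda_Q,G_T,\Lambda_{X_3}$ act on the honeycomb lattice graph $\mathcal L$ as graph automorphisms, and \[ K_4\cong\mathcal L/G_{K_4},\qquad Q\cong\mathcal L/\Lambda_Q,\qquad T\cong\mathcal L/G_T,\qquad X_3\cong\mathcal L/\Lambda_{X_3}, \] where $K_4$ is the complete graph on 4 vertices, $Q$ is the cube graph, $T$ is the truncated tetrahedron graph, and $X_3=\mathrm{Cay}(\mathfrak S_4,\{(1,4),(2,4),(3,4)\})$ is the star graph.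
   Context: The honeycomb (hexagonal) lattice graph $\mathcal L$ is the infinite bipartite graph with vertex set $B\cup W\subset\mathbb R^2$, where $B=(1,0)+\mathbb Z\mathbf v_1+\mathbb Z\mathbf v_2$ and $W=(0,0)+\mathbb Z\mathbf v_1+\mathbb Z\mathbf v_2$; $b\in B$ and $w\in W$ are joined by an edge iff $\|b-w\|=1$, and there are no edges within $B$ or within $W$. For a group $G$ acting on a graph by automorphisms, the quotient graph has the $G$-orbits of vertices as vertices, two orbits being adjacent iff some representatives are adjacent. The cube graph is the 1-skeleton of the 3-dimensional cube. The truncated tetrahedron graph is the 1-skeleton of the truncated tetrahedron (12 vertices, 3-regular). $\mathfrak S_4$ is the symmetric group on $\{1,2,3,4\}$, and $\mathrm{Cay}(G,S)$ is the simple undirected graph with vertex set $G$ in which $\xi,\eta$ are adjacent iff $\eta=\xi s$ for some $s\in S$.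
   Formalization: R is taken as the half-turn around the hexagon centre (-1,0) instead of the origin (0,0): the origin is a white vertex, and the half-turn around it sends the black vertex (1,0) to (-1,0), which is not a vertex of the honeycomb, so the groups containing it would not act. *)

theory Defs
  imports
    "HOL-Analysis.Analysis"
    "HOL-Algebra.Group_Action"
    "HOL-Algebra.Generated_Groups"
    "HOL-Algebra.Sym_Groups"
    "Graph_Theory.Graph_Theory"
begin

(* Following Graph_Theory, undirected graphs are represented by symmetric digraphs: an edge {u, v}
   is the pair of arcs (u, v), (v, u), and graph isomorphism is digraph_iso. *)

section \<open>Actions on graphs and quotient graphs\<close>

definition acts_by_automorphisms ::
  "('g, 'm) monoid_scheme \<Rightarrow> ('g \<Rightarrow> 'a \<Rightarrow> 'a) \<Rightarrow> 'a pair_pre_digraph \<Rightarrow> bool" where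
  "acts_by_automorphisms G \<phi> \<Gamma> \<longleftrightarrow>
     group_action G (pverts \<Gamma>) \<phi> \<and>
     (\<forall>g\<in>carrier G. \<forall>u\<in>pverts \<Gamma>. \<forall>v\<in>pverts \<Gamma>.
        (\<phi> g u, \<phi> g v) \<in> parcs \<Gamma> \<longleftrightarrow> (u, v) \<in> parcs \<Gamma>)"

(* An orbit containing two adjacent vertices would get a loop, so an isomorphism with a loopless
   graph includes the claim that this does not happen. *)
definition quotient_graph ::
  "('g, 'm) monoid_scheme \<Rightarrow> ('g \<Rightarrow> 'a \<Rightarrow> 'a) \<Rightarrow> 'a pair_pre_digraph \<Rightarrow> 'a set pair_pre_digraph" where
  "quotient_graph G \<phi> \<Gamma> =
     \<lparr> pverts = orbits G (pverts \<Gamma>) \<phi>,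
       parcs = {(X, Y). X \<in> orbits G (pverts \<Gamma>) \<phi> \<and> Y \<in> orbits G (pverts \<Gamma>) \<phi> \<and>
                        (\<exists>u\<in>X. \<exists>v\<in>Y. (u, v) \<in> parcs \<Gamma>)} \<rparr>"

section \<open>The honeycomb lattice\<close>

type_synonym plane = "real \<times> real"

definition v1 :: plane where "v1 = (3/2, sqrt 3 / 2)"
definition v2 :: plane where "v2 = (3/2, - sqrt 3 / 2)"

definition lattice_span :: "plane \<Rightarrow> plane \<Rightarrow> plane set" where
  "lattice_span a b = {of_int m *\<^sub>R a + of_int n *\<^sub>R b | m n. True}"

definition black :: "plane set" where "black = (+) (1, 0) ` lattice_span v1 v2"
definition white :: "plane set" where "white = (+) (0, 0) ` lattice_span v1 v2"

definition honeycomb :: "plane pair_pre_digraph" where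
  "honeycomb =
     \<lparr> pverts = black \<union> white,
       parcs = {(u, v). (u \<in> black \<and> v \<in> white \<or> u \<in> white \<and> v \<in> black) \<and> norm (u - v) = 1} \<rparr>"

section \<open>Groups of plane isometries\<close>

definition bijections_of_plane :: "(plane \<Rightarrow> plane) monoid" where
  "bijections_of_plane = BijGroup UNIV"

definition translation_group :: "plane set \<Rightarrow> (plane \<Rightarrow> plane) monoid" where
  "translation_group \<Lambda> = bijections_of_plane \<lparr>carrier := (+) ` \<Lambda>\<rparr>"

definition half_turn :: "plane \<Rightarrow> plane \<Rightarrow> plane" where
  "half_turn c = (\<lambda>x. 2 *\<^sub>R c - x)"

definition half_turn_group :: "plane set \<Rightarrow> plane \<Rightarrow> (plane \<Rightarrow> plane) monoid" where
  "half_turn_group \<Lambda> c =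
     bijections_of_plane
       \<lparr>carrier := generate bijections_of_plane (insert (half_turn c) ((+) ` \<Lambda>))\<rparr>"

(* Elements of BijGroup are extensional functions, hence the restriction. *)
definition natural_action :: "'a pair_pre_digraph \<Rightarrow> ('a \<Rightarrow> 'a) \<Rightarrow> 'a \<Rightarrow> 'a" where
  "natural_action \<Gamma> = (\<lambda>g. restrict g (pverts \<Gamma>))"

(* The origin is a white vertex, so the half-turn around it moves every black vertex to the centre
   of a hexagon and does not preserve the honeycomb; see half_turn_origin below. The half-turns
   relevant here are those around centres of hexagons, that is, around the points of
   (-1, 0) + Z v1 + Z v2. *)
definition hexagon_centre :: plane where "hexagon_centre = (-1, 0)"

lemma half_turn_origin: "half_turn (0, 0) ` pverts honeycomb \<noteq> pverts honeycomb"
proof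
  assume *: "half_turn (0, 0) ` pverts honeycomb = pverts honeycomb"
  have "(1, 0) \<in> black"
    unfolding black_def lattice_span_def
    by (rule image_eqI[where x = "of_int 0 *\<^sub>R v1 + of_int 0 *\<^sub>R v2"]) (simp, blast)
  then have "half_turn (0, 0) (1, 0) \<in> half_turn (0, 0) ` pverts honeycomb"
    by (simp add: honeycomb_def)
  then have "(-1, 0) \<in> black \<union> white"
    unfolding * by (simp add: half_turn_def honeycomb_def)
  then obtain m n :: int and k :: int
    where k: "k = 1 \<or> k = 0"
      and fst: "-1 = of_int k + of_int m * (3/2) + of_int n * (3/2 :: real)"
      and snd: "0 = of_int m * (sqrt 3 / 2) - of_int n * (sqrt 3 / 2 :: real)"
    unfolding black_def white_def lattice_span_def v1_def v2_def by force
  from snd have "m = n" by (simp flip: left_diff_distrib)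
  with fst have "-1 = real_of_int (k + 3 * m)" by simp
  then have "-1 = k + 3 * m" by linarith
  with k show False by presburger
qed

definition Lambda_Q :: "plane set" where
  "Lambda_Q = lattice_span (2 *\<^sub>R v1) (2 *\<^sub>R v2)"

definition Lambda_X3 :: "plane set" where
  "Lambda_X3 = lattice_span (2 *\<^sub>R v1 + 2 *\<^sub>R v2) (4 *\<^sub>R v1 - 2 *\<^sub>R v2)"

definition G_K4 :: "(plane \<Rightarrow> plane) monoid" where
  "G_K4 = half_turn_group Lambda_Q hexagon_centre"

definition G_T :: "(plane \<Rightarrow> plane) monoid" where
  "G_T = half_turn_group Lambda_X3 hexagon_centre"

section \<open>The four finite graphs\<close>

definition complete_graph :: "nat \<Rightarrow> nat pair_pre_digraph" where
  "complete_graph n = \<lparr> pverts = {1..n}, parcs = {(i, j). i \<in> {1..n} \<and> j \<in> {1..n} \<and> i \<noteq> j} \<rparr>"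

definition one_skeleton :: "'a::euclidean_space set \<Rightarrow> 'a pair_pre_digraph" where
  "one_skeleton P =
     \<lparr> pverts = {v. v extreme_point_of P},
       parcs = {(u, v). u extreme_point_of P \<and> v extreme_point_of P \<and> closed_segment u v edge_of P} \<rparr>"

definition cube_graph :: "(real \<times> real \<times> real) pair_pre_digraph" where
  "cube_graph = one_skeleton ({0..1} \<times> {0..1} \<times> {0..1})"

definition tetrahedron_vertices :: "(real \<times> real \<times> real) set" where
  "tetrahedron_vertices = {(1, 1, 1), (1, -1, -1), (-1, 1, -1), (-1, -1, 1)}"

(* Each corner of the regular tetrahedron is cut off at one third of the edges. *)
definition truncated_tetrahedron :: "(real \<times> real \<times> real) set" where
  "truncated_tetrahedron =
     convex hull {(2/3) *\<^sub>R a + (1/3) *\<^sub>R b | a b.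
       a \<in> tetrahedron_vertices \<and> b \<in> tetrahedron_vertices \<and> a \<noteq> b}"

definition truncated_tetrahedron_graph :: "(real \<times> real \<times> real) pair_pre_digraph" where
  "truncated_tetrahedron_graph = one_skeleton truncated_tetrahedron"

(* A simple undirected graph because it is only used for S = S^-1 not containing the unit. *)
definition Cay :: "('g, 'm) monoid_scheme \<Rightarrow> 'g set \<Rightarrow> 'g pair_pre_digraph" where
  "Cay G S =
     \<lparr> pverts = carrier G,
       parcs = {(\<xi>, \<eta>). \<xi> \<in> carrier G \<and> \<eta> \<in> carrier G \<and> (\<exists>s\<in>S. \<eta> = \<xi> \<otimes>\<^bsub>G\<^esub> s)} \<rparr>"

definition star_graph_X3 :: "(nat \<Rightarrow> nat) pair_pre_digraph" where
  "star_graph_X3 =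
     Cay (sym_group 4)
       {Transposition.transpose 1 4, Transposition.transpose 2 4, Transposition.transpose 3 4}"

end

theory Submission
  imports Defs
begin

text \<open>In the basis \<open>v1\<close>, \<open>v2\<close> a vertex of the honeycomb is a colour together with a pair of integers
  \<open>(m, n)\<close>, the black vertex \<open>(m, n)\<close> is adjacent to the white vertices \<open>(m, n)\<close>, \<open>(m + 1, n)\<close>,
  \<open>(m, n + 1)\<close>, and the half-turn around the chosen hexagon centre exchanges the black vertex
  \<open>(m, n)\<close> and the white vertex \<open>(- 1 - m, - 1 - n)\<close>. A labelling of the vertices whose fibres are
  the orbits and which maps the neighbours of every vertex onto the neighbours of its label then
  identifies the quotient with the graph of labels. The 1-skeletons are found from linear functionals
  exposing the vertices and edges, and from crossing diagonals ruling out all other edges.\<close>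

section \<open>Quotient graphs and groups of bijections\<close>

text \<open>Adjacency of orbits asks only for some adjacent representatives. Requiring that the
  labelling match neighbourhoods at every vertex turns this into a condition that can be checked one
  vertex at a time; since the four target graphs are loopless, it also excludes adjacency inside an
  orbit. The sizes fit: in the basis \<open>v1\<close>, \<open>v2\<close> the lattice
  \<open>Lambda_Q\<close> has index 4 and \<open>Lambda_X3\<close> has index 12. Translations keep
  colours, so there are 4 + 4 and 12 + 12 orbits, as many as the vertices of the cube and the
  elements of the symmetric group on four points. Every half-turn involved exchanges the colours, so
  an orbit of the larger group meets the black vertices in exactly one coset, which leaves 4 and 12
  orbits. The labels depend only on residues of the coordinates, and so each statement about the
  infinite honeycomb becomes a check of finitely many cases.\<close>

lemma digraph_iso_with_projI:
  assumes wf: "parcs A \<subseteq> pverts A \<times> pverts A"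
    and inj: "inj_on h (pverts A)"
    and verts: "pverts B = h ` pverts A"
    and arcs: "parcs B = map_prod h h ` parcs A"
  shows "digraph_iso (with_proj A) (with_proj B)"
  unfolding digraph_iso_def
proof (intro exI conjI)
  let ?f = "\<lparr>iso_verts = h, iso_arcs = map_prod h h, iso_head = snd, iso_tail = fst\<rparr>"
  have "inj_on (map_prod h h) (parcs A)"
    using map_prod_inj_on[OF inj inj] wf by (rule inj_on_subset)
  then show "pre_digraph.digraph_isomorphism (with_proj A) ?f"
    using wf inj by (auto simp: pre_digraph.digraph_isomorphism_def wf_digraph_def with_proj_def)
  show "with_proj B = app_iso ?f (with_proj A)"
    by (simp add: app_iso_def with_proj_def verts arcs)
qed

text \<open>The vertices of the graph are parametrised by \<open>e\<close>, and \<open>f\<close> is the quotient map in this parametrisation.\<close>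

lemma quotient_graph_iso:
  fixes e :: "'c \<Rightarrow> 'a" and f :: "'c \<Rightarrow> 'b"
  assumes inj: "inj e"
    and verts: "pverts \<Gamma> = range e"
    and orbit: "\<And>i. Group_Action.orbit G \<phi> (e i) = e ` {j. f j = f i}"
    and verts_H: "pverts H = range f"
    and wf: "parcs H \<subseteq> pverts H \<times> pverts H"
    and nbrs: "\<And>i. {y. (f i, y) \<in> parcs H} = f ` {j. (e i, e j) \<in> parcs \<Gamma>}"
  shows "digraph_iso (with_proj H) (with_proj (quotient_graph G \<phi> \<Gamma>))"
proof (rule digraph_iso_with_projI[where h = "\<lambda>x. e ` {j. f j = x}"])
  let ?h = "\<lambda>x. e ` {j. f j = x}"
  show "parcs H \<subseteq> pverts H \<times> pverts H" by (rule wf)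
  show "inj_on ?h (pverts H)"
    unfolding verts_H by (rule inj_onI) (auto simp: inj_image_eq_iff[OF inj])
  have orbits: "orbits G (pverts \<Gamma>) \<phi> = ?h ` range f"
    by (simp add: orbits_def Setcompr_eq_image verts image_image orbit)
  show "pverts (quotient_graph G \<phi> \<Gamma>) = ?h ` pverts H"
    by (simp add: quotient_graph_def orbits verts_H)
  show "parcs (quotient_graph G \<phi> \<Gamma>) = map_prod ?h ?h ` parcs H"
  proof -
    have adj: "(\<exists>j k. f j = x \<and> f k = y \<and> (e j, e k) \<in> parcs \<Gamma>) \<longleftrightarrow> (x, y) \<in> parcs H" for x y
    proof
      assume "\<exists>j k. f j = x \<and> f k = y \<and> (e j, e k) \<in> parcs \<Gamma>"
      then show "(x, y) \<in> parcs H" using nbrs by blast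
    next
      assume xy: "(x, y) \<in> parcs H"
      then obtain i where i: "x = f i" using wf verts_H by auto
      \<comment> \<open>Any preimage i of x will do, because \<open>nbrs\<close> lifts the arc at
        every vertex of the fibre.\<close>
      with xy have "y \<in> f ` {j. (e i, e j) \<in> parcs \<Gamma>}" unfolding nbrs[symmetric] by simp
      then show "\<exists>j k. f j = x \<and> f k = y \<and> (e j, e k) \<in> parcs \<Gamma>" using i by auto
    qed
    have map_prod_image: "(X, Y) \<in> map_prod h h ` R \<longleftrightarrow> (\<exists>(x, y)\<in>R. X = h x \<and> Y = h y)"
      for h :: "'b \<Rightarrow> 'a set" and X Y R
      by force
    have "(X, Y) \<in> parcs (quotient_graph G \<phi> \<Gamma>) \<longleftrightarrow> (X, Y) \<in> map_prod ?h ?h ` parcs H"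
      for X Y
    proof -
      have "(X, Y) \<in> parcs (quotient_graph G \<phi> \<Gamma>) \<longleftrightarrow>
          (\<exists>x\<in>range f. \<exists>y\<in>range f. X = ?h x \<and> Y = ?h y \<and>
            (\<exists>j k. f j = x \<and> f k = y \<and> (e j, e k) \<in> parcs \<Gamma>))"
        unfolding quotient_graph_def orbits by fastforce
      also have "\<dots> \<longleftrightarrow> (\<exists>x\<in>range f. \<exists>y\<in>range f. X = ?h x \<and> Y = ?h y \<and> (x, y) \<in> parcs H)"
        unfolding adj ..
      also have "\<dots> \<longleftrightarrow> (\<exists>(x, y)\<in>parcs H. X = ?h x \<and> Y = ?h y)"
        using wf unfolding verts_H by blast
      also have "\<dots> \<longleftrightarrow> (X, Y) \<in> map_prod ?h ?h ` parcs H"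
        unfolding map_prod_image ..
      finally show ?thesis .
    qed
    then show ?thesis by (simp only: set_eq_iff split_paired_All simp_thms)
  qed
qed

section \<open>Groups of bijections, translations and half-turns\<close>

lemma subgroup_BijGroup_UNIVI:
  assumes id: "id \<in> K"
    and comp: "\<And>g h. g \<in> K \<Longrightarrow> h \<in> K \<Longrightarrow> g \<circ> h \<in> K"
    and inv: "\<And>g. g \<in> K \<Longrightarrow> \<exists>h\<in>K. g \<circ> h = id \<and> h \<circ> g = id"
  shows "subgroup K (BijGroup UNIV)"
proof -
  interpret group "BijGroup UNIV" by (rule group_BijGroup)
  have Bij: "K \<subseteq> Bij UNIV"
    using inv by (auto simp: Bij_def intro: o_bij)
  \<comment> \<open>The product of \<open>BijGroup\<close> restricts the composite to the base set;
    on \<open>UNIV\<close> this changes nothing, so the premises can speak of plain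
    composition.\<close>
  have mult: "g \<otimes>\<^bsub>BijGroup UNIV\<^esub> h = g \<circ> h" if "g \<in> K" "h \<in> K" for g h
    using that Bij by (auto simp: BijGroup_def compose_def o_def subset_eq)
  have one: "\<one>\<^bsub>BijGroup UNIV\<^esub> = id" by (auto simp: BijGroup_def)
  show ?thesis
  proof (rule subgroupI)
    show "K \<subseteq> carrier (BijGroup UNIV)" using Bij by (simp add: BijGroup_def)
    show "K \<noteq> {}" using id by auto
    show "inv\<^bsub>BijGroup UNIV\<^esub> g \<in> K" if g: "g \<in> K" for g
    proof -
      obtain h where "h \<in> K" "h \<circ> g = id" using inv[OF g] by auto
      then have "h \<otimes>\<^bsub>BijGroup UNIV\<^esub> g = \<one>\<^bsub>BijGroup UNIV\<^esub>"
        using g by (simp add: mult one)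
      then have "inv\<^bsub>BijGroup UNIV\<^esub> g = h"
        using g \<open>h \<in> K\<close> Bij by (intro inv_equality) (auto simp: BijGroup_def)
      with \<open>h \<in> K\<close> show ?thesis by simp
    qed
  qed (simp add: mult comp)
qed

text \<open>Preservation in one direction suffices: the inverse of g also lies in K, which makes g
  bijective on the vertices and gives the converse implication for arcs.\<close>

lemma acts_by_automorphismsI:
  fixes \<Gamma> :: "'a pair_pre_digraph"
  assumes K: "subgroup K (BijGroup UNIV)"
    and verts: "\<And>g u. g \<in> K \<Longrightarrow> u \<in> pverts \<Gamma> \<Longrightarrow> g u \<in> pverts \<Gamma>"
    and arcs: "\<And>g u v. g \<in> K \<Longrightarrow> (u, v) \<in> parcs \<Gamma> \<Longrightarrow> (g u, g v) \<in> parcs \<Gamma>"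
  shows "acts_by_automorphisms (BijGroup UNIV\<lparr>carrier := K\<rparr>) (natural_action \<Gamma>) \<Gamma>"
proof -
  interpret B: group "BijGroup (UNIV :: 'a set)" by (rule group_BijGroup)
  interpret K: group "BijGroup UNIV\<lparr>carrier := K\<rparr>"
    using K by (rule B.subgroup_imp_group)
  interpret subgroup K "BijGroup UNIV" by (rule K)
  have Bij: "g \<in> Bij UNIV" if "g \<in> K" for g
    using subset that by (auto simp: BijGroup_def)
  have mult: "g \<otimes>\<^bsub>BijGroup UNIV\<^esub> h = g \<circ> h" if "g \<in> K" "h \<in> K" for g h
    using Bij[OF that(1)] Bij[OF that(2)] by (simp add: BijGroup_def compose_def o_def restrict_UNIV)
  have inverse: "\<exists>h\<in>K. (\<forall>x. h (g x) = x) \<and> (\<forall>x. g (h x) = x)" if g: "g \<in> K" for g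
  proof (rule bexI, intro conjI allI)
    let ?h = "inv\<^bsub>BijGroup UNIV\<^esub> g"
    show h: "?h \<in> K" using g by (rule m_inv_closed)
    have "?h \<circ> g = \<one>\<^bsub>BijGroup UNIV\<^esub>" "g \<circ> ?h = \<one>\<^bsub>BijGroup UNIV\<^esub>"
      using g h subset by (simp_all add: subset_eq mult[symmetric])
    then show "?h (g x) = x" "g (?h x) = x" for x
      by (simp_all add: BijGroup_def restrict_UNIV o_def) meson+
  qed
  have restr: "natural_action \<Gamma> g \<in> Bij (pverts \<Gamma>)" if g: "g \<in> K" for g
  proof -
    obtain h where h: "h \<in> K" "\<And>x. h (g x) = x" "\<And>x. g (h x) = x" using inverse[OF g] by auto
    have "bij_betw g (pverts \<Gamma>) (pverts \<Gamma>)"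
      by (rule bij_betw_byWitness[where f' = h]) (use g h verts in auto)
    then show ?thesis
      by (simp add: natural_action_def Bij_def)
  qed
  have "group_hom (BijGroup UNIV\<lparr>carrier := K\<rparr>) (BijGroup (pverts \<Gamma>)) (natural_action \<Gamma>)"
  proof (intro group_hom.intro group_hom_axioms.intro homI)
    show "natural_action \<Gamma> g \<in> carrier (BijGroup (pverts \<Gamma>))"
      if "g \<in> carrier (BijGroup UNIV\<lparr>carrier := K\<rparr>)" for g
      using restr that by (simp add: BijGroup_def)
    show "natural_action \<Gamma> (g \<otimes>\<^bsub>BijGroup UNIV\<lparr>carrier := K\<rparr>\<^esub> h) =
        natural_action \<Gamma> g \<otimes>\<^bsub>BijGroup (pverts \<Gamma>)\<^esub> natural_action \<Gamma> h"
      if "g \<in> carrier (BijGroup UNIV\<lparr>carrier := K\<rparr>)" "h \<in> carrier (BijGroup UNIV\<lparr>carrier := K\<rparr>)" for g h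
    proof -
      have gh: "g \<in> K" "h \<in> K" using that by auto
      have "natural_action \<Gamma> (g \<circ> h) = compose (pverts \<Gamma>) (natural_action \<Gamma> g) (natural_action \<Gamma> h)"
        using verts gh by (auto simp: natural_action_def compose_def fun_eq_iff)
      then show ?thesis
        using gh restr by (simp add: mult) (simp add: BijGroup_def)
    qed
  qed (rule K.group_axioms group_BijGroup)+
  moreover have "(natural_action \<Gamma> g u, natural_action \<Gamma> g v) \<in> parcs \<Gamma> \<longleftrightarrow> (u, v) \<in> parcs \<Gamma>"
    if g: "g \<in> K" and uv: "u \<in> pverts \<Gamma>" "v \<in> pverts \<Gamma>" for g u v
  proof -
    obtain h where h: "h \<in> K" "\<And>x. h (g x) = x" using inverse[OF g] by auto
    show ?thesis
      using arcs[OF g, of u v] arcs[OF h(1), of "g u" "g v"] h(2) uv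
      by (auto simp: natural_action_def)
  qed
  ultimately show ?thesis
    by (simp add: acts_by_automorphisms_def group_action_def)
qed

lemma orbit_natural_action:
  assumes "x \<in> pverts \<Gamma>"
  shows "Group_Action.orbit (M\<lparr>carrier := K\<rparr>) (natural_action \<Gamma>) x = (\<lambda>g. g x) ` K"
  using assms by (auto simp: Group_Action.orbit_def natural_action_def)

lemma subgroup_translations:
  fixes \<Lambda> :: "'a::real_vector set"
  assumes zero: "0 \<in> \<Lambda>" and diff: "\<And>a b. a \<in> \<Lambda> \<Longrightarrow> b \<in> \<Lambda> \<Longrightarrow> a - b \<in> \<Lambda>"
  shows "subgroup ((+) ` \<Lambda>) (BijGroup UNIV)"
proof (rule subgroup_BijGroup_UNIVI)
  have neg: "- a \<in> \<Lambda>" if "a \<in> \<Lambda>" for a using diff[OF zero that] by simp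
  show "id \<in> (+) ` \<Lambda>" using zero by (force simp: fun_eq_iff)
  show "g \<circ> h \<in> (+) ` \<Lambda>" if "g \<in> (+) ` \<Lambda>" "h \<in> (+) ` \<Lambda>" for g h
  proof -
    from that obtain a b where "a \<in> \<Lambda>" "b \<in> \<Lambda>" "g = (+) a" "h = (+) b" by auto
    then show ?thesis using diff[OF _ neg, of a b]
      by (intro image_eqI[of _ _ "a - - b"]) (auto simp: fun_eq_iff)
  qed
  show "\<exists>h\<in>(+) ` \<Lambda>. g \<circ> h = id \<and> h \<circ> g = id" if "g \<in> (+) ` \<Lambda>" for g
  proof -
    from that obtain a where "a \<in> \<Lambda>" "g = (+) a" by auto
    then show ?thesis using neg[of a]
      by (intro bexI[of _ "(+) (- a)"]) (auto simp: fun_eq_iff)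
  qed
qed

text \<open>Conjugation by a half-turn negates a translation, so the products of translations and
  half-turns fall into these two families again; every member of the second family is an
  involution.\<close>

lemma subgroup_translations_half_turns:
  assumes zero: "0 \<in> \<Lambda>" and diff: "\<And>a b. a \<in> \<Lambda> \<Longrightarrow> b \<in> \<Lambda> \<Longrightarrow> a - b \<in> \<Lambda>"
  shows "subgroup ((+) ` \<Lambda> \<union> (\<lambda>l x. l + half_turn c x) ` \<Lambda>) (BijGroup UNIV)" (is "subgroup ?K _")
proof (rule subgroup_BijGroup_UNIVI)
  have neg: "- a \<in> \<Lambda>" if "a \<in> \<Lambda>" for a using diff[OF zero that] by simp
  have add: "a + b \<in> \<Lambda>" if "a \<in> \<Lambda>" "b \<in> \<Lambda>" for a b using diff[OF that(1) neg[OF that(2)]] by simp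
  have tr: "(+) a \<in> ?K" and ht: "(\<lambda>x. a + half_turn c x) \<in> ?K" if "a \<in> \<Lambda>" for a using that by auto
  show "id \<in> ?K" using zero by (force simp: fun_eq_iff)
  show "g \<circ> h \<in> ?K" if "g \<in> ?K" "h \<in> ?K" for g h
  proof -
    from that obtain a b where ab: "a \<in> \<Lambda>" "b \<in> \<Lambda>"
      and g: "g = (+) a \<or> g = (\<lambda>x. a + half_turn c x)"
      and h: "h = (+) b \<or> h = (\<lambda>x. b + half_turn c x)" by auto
    from g h show ?thesis
    proof (elim disjE)
      assume "g = (+) a" "h = (+) b"
      then have "g \<circ> h = (+) (a + b)" by (simp add: fun_eq_iff add.assoc del: split_paired_All)
      then show ?thesis using tr[OF add[OF ab]] by simp
    next
      assume "g = (+) a" "h = (\<lambda>x. b + half_turn c x)"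
      then have "g \<circ> h = (\<lambda>x. (a + b) + half_turn c x)"
        by (simp add: fun_eq_iff add.assoc del: split_paired_All)
      then show ?thesis using ht[OF add[OF ab]] by simp
    next
      assume "g = (\<lambda>x. a + half_turn c x)" "h = (+) b"
      then have "g \<circ> h = (\<lambda>x. (a - b) + half_turn c x)"
        by (simp add: fun_eq_iff half_turn_def del: split_paired_All)
      then show ?thesis using ht[OF diff[OF ab]] by simp
    next
      assume "g = (\<lambda>x. a + half_turn c x)" "h = (\<lambda>x. b + half_turn c x)"
      then have "g \<circ> h = (+) (a - b)"
        by (simp add: fun_eq_iff half_turn_def del: split_paired_All)
      then show ?thesis using tr[OF diff[OF ab]] by simp
    qed
  qed
  show "\<exists>h\<in>?K. g \<circ> h = id \<and> h \<circ> g = id" if g: "g \<in> ?K" for g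
  proof -
    from g obtain a where a: "a \<in> \<Lambda>" and "g = (+) a \<or> g = (\<lambda>x. a + half_turn c x)" by auto
    then consider "g = (+) a" | "g = (\<lambda>x. a + half_turn c x)" by auto
    then show ?thesis
    proof cases
      case 1
      then show ?thesis using tr[OF neg[OF a]]
        by (intro bexI[of _ "(+) (- a)"]) (simp_all add: fun_eq_iff del: split_paired_All)
    next
      case 2
      then have "g \<circ> g = id" by (simp add: fun_eq_iff half_turn_def del: split_paired_All)
      then show ?thesis using g by auto
    qed
  qed
qed

text \<open>The right-hand side is a subgroup containing the generators, and each of its elements is
  a product of at most two generators. This explicit form is what makes the orbits
  computable.\<close>

lemma generate_half_turn_translations:
  assumes zero: "0 \<in> \<Lambda>" and diff: "\<And>a b. a \<in> \<Lambda> \<Longrightarrow> b \<in> \<Lambda> \<Longrightarrow> a - b \<in> \<Lambda>"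
  shows "generate (BijGroup UNIV) (insert (half_turn c) ((+) ` \<Lambda>)) =
    (+) ` \<Lambda> \<union> (\<lambda>l x. l + half_turn c x) ` \<Lambda>" (is "generate ?B ?S = ?K")
proof
  interpret group ?B by (rule group_BijGroup)
  have K: "subgroup ?K ?B" using assms by (rule subgroup_translations_half_turns)
  have "half_turn c = (\<lambda>x. 0 + half_turn c x)" by auto
  then have S: "?S \<subseteq> ?K" using zero by blast
  then show "generate ?B ?S \<subseteq> ?K" using K by (rule generate_subgroup_incl)
  show "?K \<subseteq> generate ?B ?S"
  proof
    fix g assume "g \<in> ?K"
    then consider a where "g = (+) a" "a \<in> \<Lambda>" | a where "g = (\<lambda>x. a + half_turn c x)" "a \<in> \<Lambda>" by auto
    then show "g \<in> generate ?B ?S"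
    proof cases
      case 1
      then show ?thesis by (intro generate.incl) auto
    next
      case 2
      then have "(+) a \<in> ?S" by auto
      then have "(+) a \<otimes>\<^bsub>?B\<^esub> half_turn c \<in> generate ?B ?S"
        by (intro generate.eng generate.incl) auto
      moreover have "(+) a \<in> Bij UNIV" "half_turn c \<in> Bij UNIV"
      proof -
        have "(+) a \<in> carrier ?B" "half_turn c \<in> carrier ?B"
          using subgroup.subset[OF K] S \<open>(+) a \<in> ?S\<close> by blast+
        then show "(+) a \<in> Bij UNIV" "half_turn c \<in> Bij UNIV" by (simp_all add: BijGroup_def)
      qed
      then have "(+) a \<otimes>\<^bsub>?B\<^esub> half_turn c = g"
        using 2 by (simp add: BijGroup_def compose_def restrict_UNIV)
      ultimately show ?thesis by simp
    qed
  qed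
qed

section \<open>1-skeletons of polytopes\<close>

text \<open>The points where the functional attains its maximum form a face, which is the hull of a
  subset of S; strictness leaves only u and v in that subset. The case u = v is included, so the
  same lemma exposes vertices.\<close>

lemma face_of_convex_hull_exposed_segment:
  fixes S :: "'a::euclidean_space set"
  assumes fin: "finite S" and uv: "u \<in> S" "v \<in> S"
    and eq: "c \<bullet> u = c \<bullet> v" and less: "\<And>q. q \<in> S - {u, v} \<Longrightarrow> c \<bullet> q < c \<bullet> u"
  shows "closed_segment u v face_of convex hull S"
proof -
  let ?F = "convex hull S \<inter> {x. c \<bullet> x = c \<bullet> u}"
  have "convex hull S \<subseteq> {x. c \<bullet> x \<le> c \<bullet> u}"
    using less eq by (intro hull_minimal convex_halfspace_le) force
  then have face: "?F face_of convex hull S"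
    by (intro face_of_Int_supporting_hyperplane_le) auto
  then obtain T where T: "T \<subseteq> S" "?F = convex hull T"
    using face_of_convex_hull_subset[OF finite_imp_compact[OF fin]] by metis
  have "T \<subseteq> ?F" using T hull_subset by metis
  then have "T \<subseteq> {u, v}" using T(1) less by fastforce
  then have "?F \<subseteq> convex hull {u, v}" unfolding T(2) by (rule hull_mono)
  moreover have "convex hull {u, v} \<subseteq> ?F"
    using uv eq by (intro hull_minimal face_of_imp_convex[OF face]) (auto intro: hull_inc)
  ultimately show ?thesis using face by (simp add: segment_convex_hull)
qed

text \<open>A segment between vertices fails to be an edge as soon as it is crossed by a segment between
  other vertices.\<close>

lemma one_skeleton_convex_hull:
  fixes S :: "'a::euclidean_space set"
  assumes fin: "finite S"
    and vertex: "\<And>u. u \<in> S \<Longrightarrow> \<exists>c. \<forall>q\<in>S - {u}. c \<bullet> q < c \<bullet> u"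
    and edge: "\<And>u v. u \<in> S \<Longrightarrow> v \<in> S \<Longrightarrow> E u v \<Longrightarrow>
      u \<noteq> v \<and> (\<exists>c. c \<bullet> u = c \<bullet> v \<and> (\<forall>q\<in>S - {u, v}. c \<bullet> q < c \<bullet> u))"
    and non_edge: "\<And>u v. u \<in> S \<Longrightarrow> v \<in> S \<Longrightarrow> u \<noteq> v \<Longrightarrow> \<not> E u v \<Longrightarrow>
      \<exists>p\<in>S - {u, v}. \<exists>q\<in>S. open_segment p q \<inter> closed_segment u v \<noteq> {}"
  shows "one_skeleton (convex hull S) = \<lparr>pverts = S, parcs = {(u, v). u \<in> S \<and> v \<in> S \<and> E u v}\<rparr>"
proof -
  have extreme: "u extreme_point_of convex hull S \<longleftrightarrow> u \<in> S" for u
  proof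
    assume u: "u \<in> S"
    then obtain c where "\<forall>q\<in>S - {u}. c \<bullet> q < c \<bullet> u" using vertex by blast
    then have "closed_segment u u face_of convex hull S"
      using u by (intro face_of_convex_hull_exposed_segment[OF fin, of _ _ c]) auto
    then show "u extreme_point_of convex hull S" by (simp add: face_of_singleton)
  qed (rule extreme_point_of_convex_hull)
  have "closed_segment u v edge_of convex hull S \<longleftrightarrow> E u v" if uv: "u \<in> S" "v \<in> S" for u v
  proof
    assume "E u v"
    with edge uv obtain c where "u \<noteq> v" "c \<bullet> u = c \<bullet> v" "\<forall>q\<in>S - {u, v}. c \<bullet> q < c \<bullet> u" by blast
    moreover from this have "closed_segment u v face_of convex hull S"
      using uv by (intro face_of_convex_hull_exposed_segment[OF fin, of _ _ c]) auto
    ultimately show "closed_segment u v edge_of convex hull S"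
      by (simp add: edge_of_def segment_convex_hull aff_dim_convex_hull)
  next
    assume e: "closed_segment u v edge_of convex hull S"
    then have face: "closed_segment u v face_of convex hull S" and "u \<noteq> v"
      by (auto simp: edge_of_def)
    show "E u v"
    proof (rule ccontr)
      assume "\<not> E u v"
      with non_edge[OF uv \<open>u \<noteq> v\<close>] obtain p q x where
        pq: "p \<in> S" "p \<noteq> u" "p \<noteq> v" "q \<in> S" and x: "x \<in> open_segment p q" "x \<in> closed_segment u v"
        by blast
      \<comment> \<open>A face that meets the interior of the segment from p to q contains p. Then
        p, being neither u nor v, lies strictly between them and cannot be an extreme point.\<close>
      have "p \<in> closed_segment u v"
        using face_ofD[OF face x(1) _ _ x(2)] pq by (simp add: hull_inc)
      then have "p \<in> open_segment u v" using pq by (simp add: open_segment_def)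
      then show False
        using extreme[of p] pq(1) uv by (auto simp: extreme_point_of_def hull_inc)
    qed
  qed
  then show ?thesis by (auto simp: one_skeleton_def extreme)
qed


text \<open>In every crossing used below the two segments meet at the midpoint of the non-edge; s
  locates it on the crossing segment.\<close>

lemma open_segment_meets_closed_segment:
  assumes "p \<noteq> q" "0 < s" "s < 1" "(1 - s) *\<^sub>R p + s *\<^sub>R q = (1 / 2) *\<^sub>R (u + v)"
  shows "open_segment p q \<inter> closed_segment u v \<noteq> {}"
proof -
  have "(1 / 2) *\<^sub>R (u + v) \<in> open_segment p q"
    using assms by (auto simp: in_segment)
  moreover have "(1 / 2) *\<^sub>R (u + v) \<in> closed_segment u v"
    unfolding in_segment by (rule exI[of _ "1 / 2"]) (simp add: scaleR_add_right)
  ultimately show ?thesis by blast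
qed

section \<open>The 1-skeleton of the cube\<close>

definition cube_vertices :: "(real \<times> real \<times> real) set" where
  "cube_vertices = {0, 1} \<times> {0, 1} \<times> {0, 1}"

definition cube_neighbours :: "real \<times> real \<times> real \<Rightarrow> (real \<times> real \<times> real) set" where
  "cube_neighbours = (\<lambda>(x, y, z). {(1 - x, y, z), (x, 1 - y, z), (x, y, 1 - z)})"

lemma cube_graph_eq:
  "cube_graph = \<lparr>pverts = cube_vertices,
     parcs = {(u, v). u \<in> cube_vertices \<and> v \<in> cube_vertices \<and> v \<in> cube_neighbours u}\<rparr>"
proof -
  have "{0..1::real} = convex hull {0, 1}"
    by (simp add: closed_segment_eq_real_ivl flip: segment_convex_hull)
  then have "{0..1} \<times> {0..1} \<times> {0..1} = convex hull cube_vertices"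
    by (simp only: cube_vertices_def convex_hull_Times)
  moreover have "one_skeleton (convex hull cube_vertices) = \<lparr>pverts = cube_vertices,
     parcs = {(u, v). u \<in> cube_vertices \<and> v \<in> cube_vertices \<and> v \<in> cube_neighbours u}\<rparr>"
  proof (rule one_skeleton_convex_hull)
    show "finite cube_vertices" by (simp add: cube_vertices_def)
    fix u :: "real \<times> real \<times> real" assume u: "u \<in> cube_vertices"
    obtain x y z where u_eq: "u = (x, y, z)" by (cases u)
    show "\<exists>c. \<forall>q\<in>cube_vertices - {u}. c \<bullet> q < c \<bullet> u"
      \<comment> \<open>The functional is the sign vector pointing from the centre of the cube to u.
        For the edges below, the entry of the coordinate that varies is replaced by 0.\<close>
      using u unfolding u_eq
      by (intro exI[of _ "(2 * x - 1, 2 * y - 1, 2 * z - 1)"]) (auto simp: cube_vertices_def)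
    fix v :: "real \<times> real \<times> real" assume v: "v \<in> cube_vertices"
    obtain x' y' z' where v_eq: "v = (x', y', z')" by (cases v)
    show "u \<noteq> v \<and> (\<exists>c. c \<bullet> u = c \<bullet> v \<and> (\<forall>q\<in>cube_vertices - {u, v}. c \<bullet> q < c \<bullet> u))"
      if "v \<in> cube_neighbours u"
    proof -
      from that consider "v = (1 - x, y, z)" | "v = (x, 1 - y, z)" | "v = (x, y, 1 - z)"
        by (auto simp: u_eq cube_neighbours_def)
      then show ?thesis
      proof cases
        case 1
        show ?thesis using u unfolding u_eq 1
          by (intro conjI exI[of _ "(0, 2 * y - 1, 2 * z - 1)"]) (auto simp: cube_vertices_def)
      next
        case 2
        show ?thesis using u unfolding u_eq 2
          by (intro conjI exI[of _ "(2 * x - 1, 0, 2 * z - 1)"]) (auto simp: cube_vertices_def)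
      next
        case 3
        show ?thesis using u unfolding u_eq 3
          by (intro conjI exI[of _ "(2 * x - 1, 2 * y - 1, 0)"]) (auto simp: cube_vertices_def)
      qed
    qed
    show "\<exists>p\<in>cube_vertices - {u, v}. \<exists>q\<in>cube_vertices. open_segment p q \<inter> closed_segment u v \<noteq> {}"
      if uv: "u \<noteq> v" "v \<notin> cube_neighbours u"
    \<comment> \<open>Non-adjacent vertices differ in at least two coordinates. Exchanging just one
      differing coordinate between them gives another pair of vertices with the same
      midpoint.\<close>
    proof (cases "x = x'")
      case False
      then have "(x', y, z) \<in> cube_vertices - {u, v}"
        using u v uv by (auto simp: u_eq v_eq cube_vertices_def cube_neighbours_def)
      moreover have "(x, y', z') \<in> cube_vertices"
        using u v by (auto simp: u_eq v_eq cube_vertices_def)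
      moreover have "open_segment (x', y, z) (x, y', z') \<inter> closed_segment u v \<noteq> {}"
        using False by (intro open_segment_meets_closed_segment[where s = "1 / 2"]) (auto simp: u_eq v_eq)
      ultimately show ?thesis by blast
    next
      case True
      then have "y \<noteq> y'" "z \<noteq> z'"
        using u v uv by (auto simp: u_eq v_eq cube_vertices_def cube_neighbours_def)
      then have "(x, y', z) \<in> cube_vertices - {u, v}"
        using u v by (auto simp: u_eq v_eq cube_vertices_def)
      moreover have "(x, y, z') \<in> cube_vertices"
        using u v by (auto simp: u_eq v_eq cube_vertices_def)
      moreover have "open_segment (x, y', z) (x, y, z') \<inter> closed_segment u v \<noteq> {}"
        using True \<open>y \<noteq> y'\<close>
        by (intro open_segment_meets_closed_segment[where s = "1 / 2"]) (auto simp: u_eq v_eq)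
      ultimately show ?thesis by blast
    qed
  qed
  ultimately show ?thesis by (simp add: cube_graph_def)
qed

section \<open>The 1-skeleton of the truncated tetrahedron\<close>

definition corner :: "'a::real_vector \<Rightarrow> 'a \<Rightarrow> 'a" where
  "corner a b = (2/3) *\<^sub>R a + (1/3) *\<^sub>R b"

definition corners :: "'a::real_vector set \<Rightarrow> 'a set" where
  "corners T = {corner a b | a b. a \<in> T \<and> b \<in> T \<and> a \<noteq> b}"

text \<open>The two kinds of edges: the middle thirds of the edges of the tetrahedron, and the sides
  of the triangles that replace its vertices.\<close>

definition corner_adj :: "'a::real_vector set \<Rightarrow> 'a \<Rightarrow> 'a \<Rightarrow> bool" where
  "corner_adj T u v \<longleftrightarrow> (\<exists>a\<in>T. \<exists>b\<in>T.
     a \<noteq> b \<and> u = corner a b \<and>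
     (v = corner b a \<or> (\<exists>c\<in>T - {a, b}. v = corner a c)))"

lemma cornersI: "a \<in> T \<Longrightarrow> b \<in> T \<Longrightarrow> a \<noteq> b \<Longrightarrow> corner a b \<in> corners T"
  by (auto simp: corners_def)

text \<open>The inner products of \<open>tetrahedron_vertices\<close>. With functionals written as
  combinations of the vertices, all comparisons can be made without coordinates.\<close>

locale centred_tetrahedron =
  fixes T :: "'a::euclidean_space set"
  assumes finite_T: "finite T"
    and inner_T: "a \<in> T \<Longrightarrow> b \<in> T \<Longrightarrow> a \<bullet> b = (if a = b then 3 else - 1)"
begin

text \<open>If w is the sum of t(z) z over z in T and s is the sum of the coefficients t(z), then
  the inner product of w with \<open>corner x y\<close> is (4/3)(2 t(x) + t(y)) - s. For t(a) = 3,
  t(b) = 1 and 0 elsewhere, the value 2 t(x) + t(y) = 7 is the largest for distinct x, y and is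
  reached only at (a, b).\<close>

lemma corner_functional_less:
  assumes "a \<in> T" "b \<in> T" "a \<noteq> b"
    and "x \<in> T" "y \<in> T" "x \<noteq> y" "(x, y) \<noteq> (a, b)"
  shows "(3 *\<^sub>R a + b) \<bullet> corner x y < (3 *\<^sub>R a + b) \<bullet> corner a b"
  using assms
  by (simp add: corner_def inner_add inner_T) auto

lemma corner_eq_iff:
  assumes "a \<in> T" "b \<in> T" "a \<noteq> b"
    and "x \<in> T" "y \<in> T" "x \<noteq> y"
  shows "corner x y = corner a b \<longleftrightarrow> x = a \<and> y = b"
  using corner_functional_less[OF assms] by fastforce

lemma one_skeleton_corners:
  "one_skeleton (convex hull corners T) =
     \<lparr>pverts = corners T, parcs = {(u, v). u \<in> corners T \<and> v \<in> corners T \<and> corner_adj T u v}\<rparr>"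
proof (rule one_skeleton_convex_hull)
  have "corners T \<subseteq> (\<lambda>(a, b). corner a b) ` (T \<times> T)"
    by (auto simp: corners_def)
  then show "finite (corners T)"
    by (rule finite_subset) (simp add: finite_T)
  fix u assume "u \<in> corners T"
  then obtain a b where a: "a \<in> T" and b: "b \<in> T"
    and ab: "a \<noteq> b" and u: "u = corner a b" by (auto simp: corners_def)
  show "\<exists>c. \<forall>q\<in>corners T - {u}. c \<bullet> q < c \<bullet> u"
    unfolding u
    by (intro exI[of _ "3 *\<^sub>R a + b"]) (auto simp: corners_def intro!: corner_functional_less a b ab)
  fix v assume "v \<in> corners T"
  then obtain a' b' where a': "a' \<in> T" and b': "b' \<in> T"
    and ab': "a' \<noteq> b'" and v: "v = corner a' b'" by (auto simp: corners_def)
  show "u \<noteq> v \<and> (\<exists>c. c \<bullet> u = c \<bullet> v \<and> (\<forall>q\<in>corners T - {u, v}. c \<bullet> q < c \<bullet> u))"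
    if "corner_adj T u v"
  proof -
    from that consider "a' = b" "b' = a" | "a' = a" "b' \<noteq> a" "b' \<noteq> b"
      unfolding u v corner_adj_def
      using corner_eq_iff a b ab a' b' ab' by (smt (verit) DiffD1 DiffD2 insertCI)
    then show ?thesis
    proof cases
      case 1
      \<comment> \<open>With coefficients 1 at a and b, the largest value 3 of 2 t(x) + t(y) is
        reached exactly at (a, b) and (b, a).\<close>
      have "(a + b) \<bullet> corner x y < (a + b) \<bullet> corner a b"
        if "x \<in> T" "y \<in> T" "x \<noteq> y"
          "(x, y) \<noteq> (a, b)" "(x, y) \<noteq> (b, a)" for x y
        using that a b ab by (simp add: corner_def inner_add inner_T) auto
      moreover have "(a + b) \<bullet> corner a b = (a + b) \<bullet> corner b a"
        using a b ab by (simp add: corner_def inner_add inner_T)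
      ultimately show ?thesis
        unfolding u v 1 using corner_eq_iff[OF a b ab b a] ab
        by (intro conjI exI[of _ "a + b"]) (auto simp: corners_def)
    next
      case 2
      \<comment> \<open>The coefficients 2, 1, 1 at a, b, b' give the largest value 5 exactly at (a,
        b) and (a, b').\<close>
      let ?c = "2 *\<^sub>R a + b + b'"
      have "?c \<bullet> corner x y < ?c \<bullet> corner a b"
        if "x \<in> T" "y \<in> T" "x \<noteq> y"
          "(x, y) \<noteq> (a, b)" "(x, y) \<noteq> (a, b')" for x y
        using that a b ab b' 2 by (simp add: corner_def inner_add inner_T) auto
      moreover have "?c \<bullet> corner a b = ?c \<bullet> corner a b'"
        using a b ab b' 2 by (simp add: corner_def inner_add inner_T)
      ultimately show ?thesis
        unfolding u v \<open>a' = a\<close> using corner_eq_iff[OF a b ab a b'] ab 2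
        by (intro conjI exI[of _ ?c]) (auto simp: corners_def)
    qed
  qed
  show "\<exists>p\<in>corners T - {u, v}. \<exists>q\<in>corners T. open_segment p q \<inter> closed_segment u v \<noteq> {}"
    if uv: "u \<noteq> v" "\<not> corner_adj T u v"
  proof -
    have crossing: ?thesis
      if p: "x \<in> T" "y \<in> T" "x \<noteq> y"
        and q: "x' \<in> T" "y' \<in> T" "x' \<noteq> y'"
        and ne: "(x, y) \<noteq> (a, b)" "(x, y) \<noteq> (a', b')" "(x, y) \<noteq> (x', y')"
        and s: "0 < s" "s < 1"
        and eq: "(1 - s) *\<^sub>R corner x y + s *\<^sub>R corner x' y' = (1 / 2) *\<^sub>R (u + v)" for x y x' y' s
    proof (intro bexI)
      show "corner x y \<in> corners T - {u, v}"
        using p ne corner_eq_iff[OF a b ab p] corner_eq_iff[OF a' b' ab' p] by (auto simp: u v cornersI)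
      show "corner x' y' \<in> corners T" using q by (rule cornersI)
      show "open_segment (corner x y) (corner x' y') \<inter> closed_segment u v \<noteq> {}"
        using ne corner_eq_iff[OF q p] s eq by (intro open_segment_meets_closed_segment) auto
    qed
    have "\<not> (a' = b \<and> b' = a)" "\<not> (a' = a \<and> b' \<noteq> b)" "\<not> (a' = a \<and> b' = b)"
      using uv a b ab a' b' ab' unfolding u v corner_adj_def by blast+
    \<comment> \<open>In the first three cases u and v lie on one hexagonal face. A short diagonal
      of the hexagon (cases 1 and 2) has its midpoint on a long diagonal, a quarter of the way
      along; two long diagonals (case 3) bisect each other. In case 4 all four points are distinct,
      and exchanging b with b' preserves the midpoint.\<close>
    then consider "a' = b" "b' \<noteq> a" | "a' \<noteq> a" "a' \<noteq> b" "b' = a" | "a' \<noteq> a" "a' \<noteq> b" "b' = b"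
      | "a' \<noteq> a" "a' \<noteq> b" "b' \<noteq> a" "b' \<noteq> b" by blast
    then show ?thesis
    proof cases
      case 1
      have "(3/4) *\<^sub>R corner b a + (1/4) *\<^sub>R corner b' a = (1/2) *\<^sub>R (corner a b + corner b b')"
        by (rule euclidean_eqI) (simp add: corner_def inner_simps algebra_simps)
      then show ?thesis
        using crossing[of b a b' a "1/4"] a b ab b' ab' 1 u v by auto
    next
      case 2
      have "(3/4) *\<^sub>R corner a a' + (1/4) *\<^sub>R corner b a' = (1/2) *\<^sub>R (corner a b + corner a' a)"
        by (rule euclidean_eqI) (simp add: corner_def inner_simps algebra_simps)
      then show ?thesis
        using crossing[of a a' b a' "1/4"] a b ab a' ab' 2 u v by auto
    next
      case 3
      have "(1/2) *\<^sub>R corner b a + (1/2) *\<^sub>R corner a' a = (1/2) *\<^sub>R (corner a b + corner a' b)"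
        by (rule euclidean_eqI) (simp add: corner_def inner_simps algebra_simps)
      then show ?thesis
        using crossing[of b a a' a "1/2"] a b ab a' ab' 3 u v by auto
    next
      case 4
      have "(1/2) *\<^sub>R corner a b' + (1/2) *\<^sub>R corner a' b = (1/2) *\<^sub>R (corner a b + corner a' b')"
        by (rule euclidean_eqI) (simp add: corner_def inner_simps algebra_simps)
      then show ?thesis
        using crossing[of a b' a' b "1/2"] a b ab a' b' ab' 4 u v by auto
    qed
  qed
qed

lemma corner_adj_neighbours:
  assumes "a \<in> T" "b \<in> T" "a \<noteq> b"
  shows "corner_adj T (corner a b) v \<longleftrightarrow> v \<in> insert (corner b a) (corner a ` (T - {a, b}))"
proof
  assume "corner_adj T (corner a b) v"
  then obtain x y where xy: "x \<in> T" "y \<in> T" "x \<noteq> y"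
    "corner x y = corner a b" "v = corner y x \<or> (\<exists>z\<in>T - {x, y}. v = corner x z)"
    unfolding corner_adj_def by metis
  then have "x = a" "y = b" using corner_eq_iff[OF assms] by auto
  then show "v \<in> insert (corner b a) (corner a ` (T - {a, b}))" using xy by auto
next
  assume "v \<in> insert (corner b a) (corner a ` (T - {a, b}))"
  then show "corner_adj T (corner a b) v"
    unfolding corner_adj_def using assms by (intro bexI[of _ a] bexI[of _ b]) auto
qed

end

interpretation tetrahedron: centred_tetrahedron tetrahedron_vertices
  by unfold_locales (auto simp: tetrahedron_vertices_def)

lemma truncated_tetrahedron_graph_eq:
  "truncated_tetrahedron_graph = \<lparr>pverts = corners tetrahedron_vertices,
     parcs = {(u, v). u \<in> corners tetrahedron_vertices \<and> v \<in> corners tetrahedron_vertices \<and>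
       corner_adj tetrahedron_vertices u v}\<rparr>"
  using tetrahedron.one_skeleton_corners
  by (simp add: truncated_tetrahedron_graph_def truncated_tetrahedron_def corners_def corner_def)

lemma truncated_tetrahedron_graph_neighbours:
  assumes "a \<in> tetrahedron_vertices" "b \<in> tetrahedron_vertices" "a \<noteq> b"
  shows "{v. (corner a b, v) \<in> parcs truncated_tetrahedron_graph} =
    insert (corner b a) (corner a ` (tetrahedron_vertices - {a, b}))"
proof -
  have "insert (corner a b) (insert (corner b a) (corner a ` (tetrahedron_vertices - {a, b})))
      \<subseteq> corners tetrahedron_vertices"
    using assms by (auto simp del: split_paired_Ex intro!: cornersI)
  then show ?thesis
    unfolding truncated_tetrahedron_graph_eq pair_pre_digraph.simps mem_Collect_eq prod.case
      tetrahedron.corner_adj_neighbours[OF assms] by blast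
qed

section \<open>The honeycomb in integer coordinates\<close>

definition vertex :: "bool \<times> int \<times> int \<Rightarrow> plane" where
  "vertex = (\<lambda>(black, m, n). (of_bool black, 0) + of_int m *\<^sub>R v1 + of_int n *\<^sub>R v2)"

lemma vertex_Pair:
  "vertex (b, m, n) = (of_bool b + 3/2 * of_int (m + n), sqrt 3 / 2 * of_int (m - n))"
  by (simp add: vertex_def v1_def v2_def algebra_simps)

lemma inj_vertex: "inj vertex"
proof (rule injI)
  fix i j :: "bool \<times> int \<times> int"
  obtain b m n b' m' n' where ij: "i = (b, m, n)" "j = (b', m', n')" by (metis prod_cases3)
  assume "vertex i = vertex j"
  then have fst: "of_bool b + 3/2 * real_of_int (m + n) = of_bool b' + 3/2 * real_of_int (m' + n')"
    and "m - n = m' - n'"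
    by (simp_all only: ij vertex_Pair prod.inject) simp
  \<comment> \<open>Doubling the first coordinate makes it an integer whose residue modulo 3
    determines the colour.\<close>
  have "real_of_int (2 * of_bool b + 3 * (m + n)) = real_of_int (2 * of_bool b' + 3 * (m' + n'))"
    using fst by (cases b; cases b') (simp_all add: field_simps)
  then have "2 * of_bool b + 3 * (m + n) = 2 * of_bool b' + 3 * (m' + n')"
    by (simp only: of_int_eq_iff)
  with \<open>m - n = m' - n'\<close> show "i = j" unfolding ij by (cases b; cases b'; simp) presburger+
qed

lemma black_eq: "black = range (\<lambda>(m, n). vertex (True, m, n))"
  by (force simp: black_def lattice_span_def vertex_def add.assoc)

lemma white_eq: "white = range (\<lambda>(m, n). vertex (False, m, n))"
  by (force simp: white_def lattice_span_def vertex_def zero_prod_def[symmetric])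

lemma vertex_in_black: "vertex (b, m, n) \<in> black \<longleftrightarrow> b"
  using injD[OF inj_vertex] by (force simp: black_eq)

lemma vertex_in_white: "vertex (b, m, n) \<in> white \<longleftrightarrow> \<not> b"
  using injD[OF inj_vertex] by (force simp: white_eq)

lemma pverts_honeycomb: "pverts honeycomb = range vertex"
proof -
  have "range vertex = black \<union> white"
  proof
    show "range vertex \<subseteq> black \<union> white"
      using vertex_in_black vertex_in_white by auto
    show "black \<union> white \<subseteq> range vertex"
      by (auto simp: black_eq white_eq)
  qed
  then show ?thesis by (simp add: honeycomb_def)
qed

text \<open>In terms of the sum s and the difference d of the coordinate differences, unit distance
  means 4 s + 3 s^2 + d^2 = 0. Hence s (4 + 3 s) is not positive, which for an integer s leaves only
  0 and -1.\<close>

lemma norm_vertex_diff: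
  "norm (vertex (True, m, n) - vertex (False, m', n')) = 1 \<longleftrightarrow>
    (m', n') \<in> {(m, n), (m + 1, n), (m, n + 1)}"
proof -
  define s d where "s = m + n - m' - n'" and "d = m - n - m' + n'"
  have "vertex (True, m, n) - vertex (False, m', n') = (1 + 3/2 * real_of_int s, sqrt 3 / 2 * of_int d)"
    by (simp add: vertex_Pair s_def d_def algebra_simps add_divide_distrib diff_divide_distrib)
  then have "norm (vertex (True, m, n) - vertex (False, m', n')) = 1 \<longleftrightarrow>
      (1 + 3/2 * real_of_int s)\<^sup>2 + (sqrt 3 / 2 * of_int d)\<^sup>2 = 1"
    by (simp add: norm_Pair power_mult_distrib power_divide)
  also have "\<dots> \<longleftrightarrow> real_of_int (4 * s + 3 * s\<^sup>2 + d\<^sup>2) = 0"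
  proof -
    have "(1 + 3/2 * real_of_int s)\<^sup>2 + (sqrt 3 / 2 * of_int d)\<^sup>2 =
        1 + 3/4 * real_of_int (4 * s + 3 * s\<^sup>2 + d\<^sup>2)"
      by (simp add: power_mult_distrib power_divide power2_sum)
    then show ?thesis by (simp del: of_int_add of_int_mult of_int_power)
  qed
  also have "\<dots> \<longleftrightarrow> 4 * s + 3 * s\<^sup>2 + d\<^sup>2 = 0" by (simp only: of_int_eq_0_iff)
  also have "\<dots> \<longleftrightarrow> s = 0 \<and> d = 0 \<or> s = -1 \<and> (d = 1 \<or> d = -1)"
  proof
    assume eq: "4 * s + 3 * s\<^sup>2 + d\<^sup>2 = 0"
    have "s * (4 + 3 * s) = 4 * s + 3 * s\<^sup>2" by (simp add: power2_eq_square algebra_simps)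
    then have "s * (4 + 3 * s) \<le> 0"
      using eq zero_le_power2[of d] by linarith
    then have "s = 0 \<or> s = -1" by (auto simp: mult_le_0_iff)
    then show "s = 0 \<and> d = 0 \<or> s = -1 \<and> (d = 1 \<or> d = -1)"
      using eq power2_eq_1_iff[of d] by auto
  qed auto
  also have "\<dots> \<longleftrightarrow> (m', n') \<in> {(m, n), (m + 1, n), (m, n + 1)}"
    unfolding s_def d_def by simp presburger
  finally show ?thesis .
qed

lemma insert_Collect_eq: "{x. x = a \<or> x = b \<or> x = c} = {a, b, c}"
  by auto

lemma arc_from_black:
  "(vertex (True, m, n), vertex j) \<in> parcs honeycomb \<longleftrightarrow>
    j \<in> {(False, m, n), (False, m + 1, n), (False, m, n + 1)}"
proof -
  obtain b m' n' where j: "j = (b, m', n')" by (cases j)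
  show ?thesis
    using norm_vertex_diff[of m n m' n']
    by (auto simp: j honeycomb_def vertex_in_black vertex_in_white)
qed

lemma arc_from_white:
  "(vertex (False, m, n), vertex j) \<in> parcs honeycomb \<longleftrightarrow>
    j \<in> {(True, m, n), (True, m - 1, n), (True, m, n - 1)}"
proof -
  obtain b m' n' where j: "j = (b, m', n')" by (cases j)
  show ?thesis
    using norm_vertex_diff[of m' n' m n]
    by (auto simp: j honeycomb_def vertex_in_black vertex_in_white norm_minus_commute)
qed

section \<open>Groups of a sublattice acting on the honeycomb\<close>

definition sublattice :: "(int \<times> int) set \<Rightarrow> plane set" where
  "sublattice L = (\<lambda>(a, b). of_int a *\<^sub>R v1 + of_int b *\<^sub>R v2) ` L"

lemma translate_vertex:
  "(of_int a *\<^sub>R v1 + of_int b *\<^sub>R v2) + vertex (c, m, n) = vertex (c, m + a, n + b)"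
  by (simp add: vertex_def algebra_simps)

lemma half_turn_vertex:
  "(of_int a *\<^sub>R v1 + of_int b *\<^sub>R v2) + half_turn hexagon_centre (vertex (c, m, n)) =
    vertex (\<not> c, a - 1 - m, b - 1 - n)"
  by (cases c) (simp_all add: vertex_Pair half_turn_def hexagon_centre_def v1_def v2_def algebra_simps
      add_divide_distrib diff_divide_distrib)

lemma parcs_honeycombE:
  assumes "(u, v) \<in> parcs honeycomb"
  obtains i j where "u = vertex i" "v = vertex j"
proof -
  have "u \<in> pverts honeycomb" "v \<in> pverts honeycomb"
    using assms by (auto simp: honeycomb_def)
  then show ?thesis using that unfolding pverts_honeycomb by blast
qed

text \<open>L is a subgroup of the coordinate group; the geometry enters only through
  \<open>sublattice\<close>, so that orbits can be handled by integer arithmetic.\<close>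

locale index_lattice =
  fixes L :: "(int \<times> int) set"
  assumes zero: "(0, 0) \<in> L"
    and diff: "(a, b) \<in> L \<Longrightarrow> (c, d) \<in> L \<Longrightarrow> (a - c, b - d) \<in> L"
begin

lemma zero_in_sublattice: "0 \<in> sublattice L"
  unfolding sublattice_def using zero by (rule rev_image_eqI) simp

lemma diff_in_sublattice:
  assumes "x \<in> sublattice L" "y \<in> sublattice L"
  shows "x - y \<in> sublattice L"
proof -
  obtain a b c d where "(a, b) \<in> L" "(c, d) \<in> L"
    and xy: "x = of_int a *\<^sub>R v1 + of_int b *\<^sub>R v2" "y = of_int c *\<^sub>R v1 + of_int d *\<^sub>R v2"
    using assms by (auto simp: sublattice_def)
  from diff[OF this(1,2)] show ?thesis
    unfolding sublattice_def by (rule rev_image_eqI) (simp add: xy algebra_simps)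
qed

lemma translation_group_eq:
  "translation_group (sublattice L) = BijGroup UNIV\<lparr>carrier := (+) ` sublattice L\<rparr>"
  by (simp add: translation_group_def bijections_of_plane_def)

lemma half_turn_group_eq:
  "half_turn_group (sublattice L) c = BijGroup UNIV
     \<lparr>carrier := (+) ` sublattice L \<union> (\<lambda>l x. l + half_turn c x) ` sublattice L\<rparr>"
  by (simp add: half_turn_group_def bijections_of_plane_def
      generate_half_turn_translations zero_in_sublattice diff_in_sublattice)

lemma translation_preserves:
  assumes "g \<in> (+) ` sublattice L"
  shows "u \<in> pverts honeycomb \<Longrightarrow> g u \<in> pverts honeycomb"
    and "(u, v) \<in> parcs honeycomb \<Longrightarrow> (g u, g v) \<in> parcs honeycomb"
proof -
  obtain a b where g: "g = (+) (of_int a *\<^sub>R v1 + of_int b *\<^sub>R v2)"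
    using assms by (auto simp: sublattice_def)
  show "u \<in> pverts honeycomb \<Longrightarrow> g u \<in> pverts honeycomb"
    by (auto simp: g pverts_honeycomb translate_vertex)
  assume uv: "(u, v) \<in> parcs honeycomb"
  obtain c m n c' m' n' where "u = vertex (c, m, n)" "v = vertex (c', m', n')"
    using parcs_honeycombE[OF uv] by (metis prod_cases3)
  then show "(g u, g v) \<in> parcs honeycomb"
    using uv by (cases c) (auto simp: g translate_vertex arc_from_black arc_from_white)
qed

lemma half_turn_preserves:
  assumes "g \<in> (\<lambda>l x. l + half_turn hexagon_centre x) ` sublattice L"
  shows "u \<in> pverts honeycomb \<Longrightarrow> g u \<in> pverts honeycomb"
    and "(u, v) \<in> parcs honeycomb \<Longrightarrow> (g u, g v) \<in> parcs honeycomb"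
proof -
  obtain a b where g: "g = (\<lambda>x. of_int a *\<^sub>R v1 + of_int b *\<^sub>R v2 + half_turn hexagon_centre x)"
    using assms by (auto simp: sublattice_def)
  show "u \<in> pverts honeycomb \<Longrightarrow> g u \<in> pverts honeycomb"
    by (auto simp: g pverts_honeycomb half_turn_vertex)
  assume uv: "(u, v) \<in> parcs honeycomb"
  obtain c m n c' m' n' where "u = vertex (c, m, n)" "v = vertex (c', m', n')"
    using parcs_honeycombE[OF uv] by (metis prod_cases3)
  then show "(g u, g v) \<in> parcs honeycomb"
    using uv by (cases c) (auto simp: g half_turn_vertex arc_from_black arc_from_white)
qed

lemma subgroup_translations_sublattice: "subgroup ((+) ` sublattice L) (BijGroup UNIV)"
  using zero_in_sublattice diff_in_sublattice by (rule subgroup_translations)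

lemma subgroup_half_turns_sublattice:
  "subgroup ((+) ` sublattice L \<union> (\<lambda>l x. l + half_turn c x) ` sublattice L) (BijGroup UNIV)"
  using zero_in_sublattice diff_in_sublattice by (rule subgroup_translations_half_turns)

lemma translation_group_acts:
  "acts_by_automorphisms (translation_group (sublattice L)) (natural_action honeycomb) honeycomb"
  unfolding translation_group_eq
  using subgroup_translations_sublattice translation_preserves by (rule acts_by_automorphismsI)

lemma half_turn_group_acts:
  "acts_by_automorphisms (half_turn_group (sublattice L) hexagon_centre)
     (natural_action honeycomb) honeycomb"
  unfolding half_turn_group_eq
proof (rule acts_by_automorphismsI[OF subgroup_half_turns_sublattice])
  fix g u v
  assume "g \<in> (+) ` sublattice L \<union> (\<lambda>l x. l + half_turn hexagon_centre x) ` sublattice L"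
  then consider "g \<in> (+) ` sublattice L"
    | "g \<in> (\<lambda>l x. l + half_turn hexagon_centre x) ` sublattice L" by blast
  note g = this
  show "g u \<in> pverts honeycomb" if "u \<in> pverts honeycomb"
    using g that by cases (rule translation_preserves half_turn_preserves, assumption+)+
  show "(g u, g v) \<in> parcs honeycomb" if "(u, v) \<in> parcs honeycomb"
    using g that by cases (rule translation_preserves half_turn_preserves, assumption+)+
qed

lemma image_sublattice:
  "h ` sublattice L = (\<lambda>(a, b). h (of_int a *\<^sub>R v1 + of_int b *\<^sub>R v2)) ` L"
  by (simp only: sublattice_def image_image case_prod_unfold)

lemma translation_orbit:
  "Group_Action.orbit (translation_group (sublattice L)) (natural_action honeycomb) (vertex (c, m, n)) =
    (\<lambda>(a, b). vertex (c, m + a, n + b)) ` L"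
proof -
  have v: "vertex (c, m, n) \<in> pverts honeycomb" by (simp add: pverts_honeycomb)
  show ?thesis
    unfolding translation_group_eq orbit_natural_action[OF v]
      image_image image_sublattice case_prod_unfold translate_vertex ..
qed

lemma half_turn_orbit:
  "Group_Action.orbit (half_turn_group (sublattice L) hexagon_centre) (natural_action honeycomb)
      (vertex (c, m, n)) =
    (\<lambda>(a, b). vertex (c, m + a, n + b)) ` L \<union> (\<lambda>(a, b). vertex (\<not> c, a - 1 - m, b - 1 - n)) ` L"
proof -
  have v: "vertex (c, m, n) \<in> pverts honeycomb" by (simp add: pverts_honeycomb)
  show ?thesis
    unfolding half_turn_group_eq orbit_natural_action[OF v]
      image_Un image_image image_sublattice case_prod_unfold translate_vertex half_turn_vertex ..
qed

text \<open>Translations preserve the colour, so an orbit is one coset of L in one colour. The last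
  two premises list the labels of the three honeycomb neighbours of a black and of a white
  vertex.\<close>

lemma translation_quotient:
  fixes f :: "bool \<Rightarrow> int \<Rightarrow> int \<Rightarrow> 'b"
  assumes fibre: "\<And>c m n c' m' n'. f c m n = f c' m' n' \<longleftrightarrow> c = c' \<and> (m - m', n - n') \<in> L"
    and verts: "pverts H = range (\<lambda>(c, m, n). f c m n)"
    and wf: "parcs H \<subseteq> pverts H \<times> pverts H"
    and from_black: "\<And>m n. {y. (f True m n, y) \<in> parcs H} =
      {f False m n, f False (m + 1) n, f False m (n + 1)}"
    and from_white: "\<And>m n. {y. (f False m n, y) \<in> parcs H} =
      {f True m n, f True (m - 1) n, f True m (n - 1)}"
  shows "digraph_iso (with_proj H)
    (with_proj (quotient_graph (translation_group (sublattice L)) (natural_action honeycomb) honeycomb))"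
proof (rule quotient_graph_iso[OF inj_vertex pverts_honeycomb])
  let ?f = "\<lambda>(c, m, n). f c m n"
  show "pverts H = range ?f" by (rule verts)
  show "parcs H \<subseteq> pverts H \<times> pverts H" by (rule wf)
  fix i :: "bool \<times> int \<times> int"
  obtain c m n where i: "i = (c, m, n)" by (cases i)
  have "{j. ?f j = ?f i} = (\<lambda>(a, b). (c, m + a, n + b)) ` L"
  proof (rule Set.set_eqI)
    fix j :: "bool \<times> int \<times> int"
    obtain c' m' n' where j: "j = (c', m', n')" by (cases j)
    have "j \<in> (\<lambda>(a, b). (c, m + a, n + b)) ` L" if "c' = c" "(m' - m, n' - n) \<in> L"
      using that(2) by (rule rev_image_eqI) (simp add: j that(1))
    then show "j \<in> {j. ?f j = ?f i} \<longleftrightarrow> j \<in> (\<lambda>(a, b). (c, m + a, n + b)) ` L"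
      by (auto simp: i j fibre)
  qed
  then show "Group_Action.orbit (translation_group (sublattice L)) (natural_action honeycomb) (vertex i) =
      vertex ` {j. ?f j = ?f i}"
    by (simp add: i translation_orbit image_image split_beta)
  show "{y. (?f i, y) \<in> parcs H} = ?f ` {j. (vertex i, vertex j) \<in> parcs honeycomb}"
    unfolding i by (cases c) (simp_all add: from_black from_white arc_from_black arc_from_white insert_Collect_eq)
qed

text \<open>Every orbit of a group with half-turns contains black vertices, so it suffices to label these.\<close>

lemma half_turn_quotient:
  fixes f :: "int \<Rightarrow> int \<Rightarrow> 'b"
  assumes fibre: "\<And>m n m' n'. f m n = f m' n' \<longleftrightarrow> (m - m', n - n') \<in> L"
    and verts: "pverts H = range (\<lambda>(m, n). f m n)"
    and wf: "parcs H \<subseteq> pverts H \<times> pverts H"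
    and nbrs: "\<And>m n. {y. (f m n, y) \<in> parcs H} =
      {f (- 1 - m) (- 1 - n), f (- 2 - m) (- 1 - n), f (- 1 - m) (- 2 - n)}"
  shows "digraph_iso (with_proj H)
    (with_proj (quotient_graph (half_turn_group (sublattice L) hexagon_centre)
      (natural_action honeycomb) honeycomb))"
proof (rule quotient_graph_iso[OF inj_vertex pverts_honeycomb])
  \<comment> \<open>A white vertex takes the label of the black vertex with which the half-turn
    around \<open>hexagon_centre\<close> exchanges it. The right-hand side of \<open>nbrs\<close>
    arises in this way from the white neighbours of a black vertex, and the same premise at (- 1 -
    m, - 1 - n) covers the white vertices.\<close>
  let ?f = "\<lambda>(c, m, n). if c then f m n else f (- 1 - m) (- 1 - n)"
  have neg: "(- a, - b) \<in> L" if "(a, b) \<in> L" for a b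
    using diff[OF zero that] by simp
  show "pverts H = range ?f"
  proof
    show "pverts H \<subseteq> range ?f"
    proof
      fix y assume "y \<in> pverts H"
      then obtain m n where "y = f m n" unfolding verts by auto
      then show "y \<in> range ?f" by (intro image_eqI[of _ _ "(True, m, n)"]) auto
    qed
    have "f m n \<in> pverts H" for m n
      unfolding verts by (rule image_eqI[of _ _ "(m, n)"]) auto
    then show "range ?f \<subseteq> pverts H" by auto
  qed
  show "parcs H \<subseteq> pverts H \<times> pverts H" by (rule wf)
  fix i :: "bool \<times> int \<times> int"
  obtain c m n where i: "i = (c, m, n)" by (cases i)
  have "{j. ?f j = ?f i} =
      (\<lambda>(a, b). (c, m + a, n + b)) ` L \<union> (\<lambda>(a, b). (\<not> c, a - 1 - m, b - 1 - n)) ` L"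
  proof (rule Set.set_eqI)
    fix j :: "bool \<times> int \<times> int"
    obtain c' m' n' where j: "j = (c', m', n')" by (cases j)
    have 1: "j \<in> (\<lambda>(a, b). (c, m + a, n + b)) ` L \<longleftrightarrow> c' = c \<and> (m' - m, n' - n) \<in> L"
      by (force simp: j)
    have 2: "j \<in> (\<lambda>(a, b). (\<not> c, a - 1 - m, b - 1 - n)) ` L \<longleftrightarrow>
        c' = (\<not> c) \<and> (m' + m + 1, n' + n + 1) \<in> L"
      by (force simp: j)
    \<comment> \<open>The premise \<open>fibre\<close> produces these differences with either sign;
      \<open>neg\<close> reconciles them.\<close>
    have "?f j = ?f i \<longleftrightarrow> (if c' = c then (m' - m, n' - n) \<in> L else (m' + m + 1, n' + n + 1) \<in> L)"
      using neg[of "m' - m" "n' - n"] neg[of "m - m'" "n - n'"]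
        neg[of "m' + m + 1" "n' + n + 1"] neg[of "- 1 - m' - m" "- 1 - n' - n"]
      by (cases c; cases c') (auto simp: i j fibre algebra_simps)
    then show "j \<in> {j. ?f j = ?f i} \<longleftrightarrow>
        j \<in> (\<lambda>(a, b). (c, m + a, n + b)) ` L \<union> (\<lambda>(a, b). (\<not> c, a - 1 - m, b - 1 - n)) ` L"
      unfolding Un_iff 1 2 by auto
  qed
  then show "Group_Action.orbit (half_turn_group (sublattice L) hexagon_centre)
      (natural_action honeycomb) (vertex i) = vertex ` {j. ?f j = ?f i}"
    by (simp add: i half_turn_orbit image_image image_Un split_beta)
  show "{y. (?f i, y) \<in> parcs H} = ?f ` {j. (vertex i, vertex j) \<in> parcs honeycomb}"
    unfolding i by (cases c) (simp_all add: nbrs arc_from_black arc_from_white insert_Collect_eq)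
qed

end

section \<open>The four quotients\<close>

lemma index_lattice_Q: "index_lattice {(a, b). even a \<and> even b}"
  by unfold_locales auto

lemma index_lattice_X3: "index_lattice {(a, b). even b \<and> 6 dvd (a - b)}"
proof
  fix a b c d :: int
  assume "(a, b) \<in> {(a, b). even b \<and> 6 dvd (a - b)}" "(c, d) \<in> {(a, b). even b \<and> 6 dvd (a - b)}"
  then have "even b" "even d" "6 dvd (a - b)" "6 dvd (c - d)" by auto
  moreover have "a - c - (b - d) = (a - b) - (c - d)" by simp
  ultimately show "(a - c, b - d) \<in> {(a, b). even b \<and> 6 dvd (a - b)}" by (simp only: mem_Collect_eq prod.case) simp
qed simp

lemma lattice_span_eq: "lattice_span a b = range (\<lambda>(m, n). of_int m *\<^sub>R a + of_int n *\<^sub>R b)"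
proof -
  have "{t m n | m n. True} = range (\<lambda>(m, n). t m n)" for t :: "int \<Rightarrow> int \<Rightarrow> 'z"
    by auto
  then show ?thesis by (simp only: lattice_span_def)
qed

lemma Lambda_Q_eq: "Lambda_Q = sublattice {(a, b). even a \<and> even b}"
proof -
  have "of_int m *\<^sub>R (2 *\<^sub>R v1) + of_int n *\<^sub>R (2 *\<^sub>R v2) =
      of_int (2 * m) *\<^sub>R v1 + of_int (2 * n) *\<^sub>R v2" for m n :: int
    by (simp add: mult.commute)
  then have "Lambda_Q = (\<lambda>(a, b). of_int a *\<^sub>R v1 + of_int b *\<^sub>R v2) ` range (\<lambda>(m, n). (2 * m, 2 * n))"
    by (simp only: Lambda_Q_def lattice_span_eq image_image case_prod_unfold fst_conv snd_conv)
  also have "range (\<lambda>(m, n). (2 * m, 2 * n)) = {(a :: int, b :: int). even a \<and> even b}"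
    by (auto elim!: evenE)
  finally show ?thesis by (simp only: sublattice_def)
qed

text \<open>The generators have coordinates (2, 2) and (4, -2). The combination with coefficients m,
  n has coordinate difference 6 n, and for given n its second coordinate 2 m - 2 n is an arbitrary
  even number.\<close>

lemma Lambda_X3_eq: "Lambda_X3 = sublattice {(a, b). even b \<and> 6 dvd (a - b)}"
proof -
  have "of_int m *\<^sub>R (2 *\<^sub>R v1 + 2 *\<^sub>R v2) + of_int n *\<^sub>R (4 *\<^sub>R v1 - 2 *\<^sub>R v2) =
      of_int (2 * m + 4 * n) *\<^sub>R v1 + of_int (2 * m - 2 * n) *\<^sub>R v2" for m n :: int
    by (simp add: algebra_simps)
  then have "Lambda_X3 = (\<lambda>(a, b). of_int a *\<^sub>R v1 + of_int b *\<^sub>R v2) `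
      range (\<lambda>(m, n). (2 * m + 4 * n, 2 * m - 2 * n))"
    by (simp only: Lambda_X3_def lattice_span_eq image_image case_prod_unfold fst_conv snd_conv)
  also have "range (\<lambda>(m, n). (2 * m + 4 * n, 2 * m - 2 * n)) = {(a :: int, b). even b \<and> 6 dvd (a - b)}"
  proof (intro equalityI subsetI)
    fix x :: "int \<times> int" assume "x \<in> {(a, b). even b \<and> 6 dvd (a - b)}"
    then obtain a b k n where x: "x = (a, b)" "b = 2 * k" "a - b = 6 * n" by (auto elim!: dvdE)
    then have "x = (2 * (k + n) + 4 * n, 2 * (k + n) - 2 * n)" by simp
    then show "x \<in> range (\<lambda>(m, n). (2 * m + 4 * n, 2 * m - 2 * n))"
      by (intro image_eqI[of _ _ "(k + n, n)"]) simp_all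
  next
    fix x :: "int \<times> int" assume "x \<in> range (\<lambda>(m, n). (2 * m + 4 * n, 2 * m - 2 * n))"
    then obtain m n where x: "x = (2 * m + 4 * n, 2 * m - 2 * n)" by auto
    have "2 * m + 4 * n - (2 * m - 2 * n) = 6 * n" by simp
    then show "x \<in> {(a, b). even b \<and> 6 dvd (a - b)}" unfolding x by simp
  qed
  finally show ?thesis by (simp only: sublattice_def)
qed

section \<open>The complete graph and the cube\<close>

definition label_K4 :: "int \<Rightarrow> int \<Rightarrow> nat" where
  "label_K4 m n = 1 + of_bool (odd m) + 2 * of_bool (odd n)"

text \<open>The labels are the four parity classes of (m, n). The three neighbours change both
  parities, only that of n, and only that of m, so all other classes are reached.\<close>

lemma K4_iso:
  "digraph_iso (with_proj (complete_graph 4))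
     (with_proj (quotient_graph G_K4 (natural_action honeycomb) honeycomb))"
  unfolding G_K4_def Lambda_Q_eq
proof (rule index_lattice.half_turn_quotient[OF index_lattice_Q])
  show "label_K4 m n = label_K4 m' n' \<longleftrightarrow> (m - m', n - n') \<in> {(a, b). even a \<and> even b}" for m n m' n'
    by (cases "even m"; cases "even n"; cases "even m'"; cases "even n'") (simp_all add: label_K4_def)
  have "label_K4 m n \<in> {1..4}" for m n
    by (simp add: label_K4_def of_bool_def)
  moreover have "y \<in> range (\<lambda>(m, n). label_K4 m n)" if "y \<in> {1..4}" for y
  proof -
    from that consider "y = 1" | "y = 2" | "y = 3" | "y = 4" by fastforce
    \<comment> \<open>Decoding the label: m is odd iff y is even, and n is odd iff y is at least
      3.\<close>
    then have "y = label_K4 (of_bool (even y)) (of_bool (3 \<le> y))"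
      by cases (simp_all add: label_K4_def)
    then show ?thesis by (intro image_eqI[of _ _ "(of_bool (even y), of_bool (3 \<le> y))"]) simp_all
  qed
  ultimately have "range (\<lambda>(m, n). label_K4 m n) = {1..4}" by auto
  then show "pverts (complete_graph 4) = range (\<lambda>(m, n). label_K4 m n)"
    by (simp only: complete_graph_def pair_pre_digraph.simps)
  show "parcs (complete_graph 4) \<subseteq> pverts (complete_graph 4) \<times> pverts (complete_graph 4)"
    by (auto simp: complete_graph_def)
  fix m n :: int
  consider "even m" "even n" | "even m" "odd n" | "odd m" "even n" | "odd m" "odd n" by blast
  then show "{y. (label_K4 m n, y) \<in> parcs (complete_graph 4)} =
      {label_K4 (- 1 - m) (- 1 - n), label_K4 (- 2 - m) (- 1 - n), label_K4 (- 1 - m) (- 2 - n)}"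
    by cases (auto simp: complete_graph_def label_K4_def)
qed

text \<open>The third coordinate flips with the colour and with the parity of m + n. An edge that
  changes m or n flips both, so it alters only the first or second coordinate; an edge that keeps m
  and n alters only the third.\<close>

definition label_Q :: "bool \<Rightarrow> int \<Rightarrow> int \<Rightarrow> real \<times> real \<times> real" where
  "label_Q c m n = (of_bool (odd m), of_bool (odd n), of_bool (odd (m + n) = c))"

lemma cube_graph_neighbours:
  assumes "u \<in> cube_vertices"
  shows "{v. (u, v) \<in> parcs cube_graph} = cube_neighbours u"
proof -
  obtain x y z where u: "u = (x, y, z)" by (cases u)
  have "x = 0 \<or> x = 1" "y = 0 \<or> y = 1" "z = 0 \<or> z = 1"
    using assms by (auto simp: u cube_vertices_def)
  then have "cube_neighbours u \<subseteq> cube_vertices"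
    by (auto simp: u cube_neighbours_def cube_vertices_def)
  with assms show ?thesis by (auto simp: cube_graph_eq)
qed

lemma Q_iso:
  "digraph_iso (with_proj cube_graph)
     (with_proj (quotient_graph (translation_group Lambda_Q) (natural_action honeycomb) honeycomb))"
  unfolding Lambda_Q_eq
proof (rule index_lattice.translation_quotient[OF index_lattice_Q])
  show "label_Q c m n = label_Q c' m' n' \<longleftrightarrow>
      c = c' \<and> (m - m', n - n') \<in> {(a, b). even a \<and> even b}" for c m n c' m' n'
    by (cases c; cases c'; cases "even m"; cases "even n"; cases "even m'"; cases "even n'")
      (simp_all add: label_Q_def)
  have label: "label_Q c m n \<in> cube_vertices" for c m n
    by (simp only: label_Q_def cube_vertices_def mem_Times_iff fst_conv snd_conv) (simp add: of_bool_def)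
  show "pverts cube_graph = range (\<lambda>(c, m, n). label_Q c m n)"
  proof
    show "pverts cube_graph \<subseteq> range (\<lambda>(c, m, n). label_Q c m n)"
    proof
      fix v assume "v \<in> pverts cube_graph"
      then obtain x y z where v: "v = (x, y, z)" and xyz: "x = 0 \<or> x = 1" "y = 0 \<or> y = 1" "z = 0 \<or> z = 1"
        by (auto simp: cube_graph_eq cube_vertices_def)
      \<comment> \<open>The parities of m and n are read off from x and y; the colour then solves
        the equation for the third coordinate.\<close>
      let ?i = "(((x = 1) \<noteq> (y = 1)) = (z = 1), of_bool (x = 1), of_bool (y = 1))"
      have "v = (\<lambda>(c, m, n). label_Q c m n) ?i"
        using xyz by (elim disjE) (simp_all add: v label_Q_def)
      then show "v \<in> range (\<lambda>(c, m, n). label_Q c m n)" by (rule image_eqI) simp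
    qed
  qed (auto simp: cube_graph_eq label)
  show "parcs cube_graph \<subseteq> pverts cube_graph \<times> pverts cube_graph"
    by (auto simp: cube_graph_eq)
  fix m n :: int
  have nbrs: "{y. (label_Q c m n, y) \<in> parcs cube_graph} = cube_neighbours (label_Q c m n)" for c
    using label by (rule cube_graph_neighbours)
  show "{y. (label_Q True m n, y) \<in> parcs cube_graph} =
      {label_Q False m n, label_Q False (m + 1) n, label_Q False m (n + 1)}"
    unfolding nbrs
    by (cases "even m"; cases "even n") (simp_all add: cube_neighbours_def label_Q_def insert_commute)
  show "{y. (label_Q False m n, y) \<in> parcs cube_graph} =
      {label_Q True m n, label_Q True (m - 1) n, label_Q True m (n - 1)}"
    unfolding nbrs
    by (cases "even m"; cases "even n") (simp_all add: cube_neighbours_def label_Q_def insert_commute)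
qed

section \<open>Numbering the twelve cosets, and the truncated tetrahedron\<close>

definition index12 :: "int \<Rightarrow> int \<Rightarrow> nat" where
  "index12 m n = nat (6 * (n mod 2) + (m - n) mod 6)"

lemma index12_less: "index12 m n < 12"
  using pos_mod_bound[of 2 n] pos_mod_bound[of 6 "m - n"] by (simp add: index12_def)

text \<open>The leading digit n mod 2 and the trailing digit (m - n) mod 6 are the two residues that
  determine a coset of the lattice \<open>Lambda_X3\<close>, so the numbers below 12 enumerate its
  cosets.\<close>

lemma index12_eq_iff:
  "index12 m n = index12 m' n' \<longleftrightarrow> (m - m', n - n') \<in> {(a, b). even b \<and> 6 dvd (a - b)}"
proof -
  have digits: "6 * p + x = 6 * q + y \<longleftrightarrow> p = q \<and> x = y" if "0 \<le> x" "x < 6" "0 \<le> y" "y < 6"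
    for p q x y :: int
    using that by presburger
  have "index12 m n = index12 m' n' \<longleftrightarrow>
      6 * (n mod 2) + (m - n) mod 6 = 6 * (n' mod 2) + (m' - n') mod 6"
    unfolding index12_def by (rule eq_nat_nat_iff) simp_all
  also have "\<dots> \<longleftrightarrow> n mod 2 = n' mod 2 \<and> (m - n) mod 6 = (m' - n') mod 6"
    by (rule digits) simp_all
  also have "\<dots> \<longleftrightarrow> 2 dvd (n - n') \<and> 6 dvd ((m - n) - (m' - n'))"
    by (simp only: mod_eq_dvd_iff)
  also have "(m - n) - (m' - n') = (m - m') - (n - n')" by simp
  finally show ?thesis by (simp only: mem_Collect_eq prod.case)
qed

lemma index12_surj:
  assumes "j < 12"
  obtains m n where "index12 m n = j"
proof
  \<comment> \<open>The two digits of j give n and m - n.\<close>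
  let ?q = "int j div 6" and ?r = "int j mod 6"
  have "?q = 0 \<or> ?q = 1" using assms by linarith
  then have "?q mod 2 = ?q" by auto
  then have "6 * (?q mod 2) + (?r + ?q - ?q) mod 6 = int j" by simp
  then show "index12 (?r + ?q) ?q = j" by (simp only: index12_def nat_int)
qed

lemma range_nth_index12:
  assumes "length xs = 12"
  shows "range (\<lambda>(m, n). xs ! index12 m n) = set xs"
proof
  show "range (\<lambda>(m, n). xs ! index12 m n) \<subseteq> set xs"
    using index12_less assms by auto
  show "set xs \<subseteq> range (\<lambda>(m, n). xs ! index12 m n)"
  proof
    fix x assume "x \<in> set xs"
    then obtain j where "j < 12" "x = xs ! j" using assms by (auto simp: in_set_conv_nth)
    then obtain m n where "x = xs ! index12 m n" using index12_surj[of j] by metis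
    then show "x \<in> range (\<lambda>(m, n). xs ! index12 m n)" by (intro image_eqI[of _ _ "(m, n)"]) simp_all
  qed
qed

text \<open>This makes the neighbour conditions finite: (m, n) is congruent to one of twelve
  representatives (i + k, i), and the congruence survives shifts and negation. The negated form
  serves the neighbours under half-turns.\<close>

lemma index12_reduce:
  obtains i k :: int where "i \<in> {0, 1}" "k \<in> {0, 1, 2, 3, 4, 5}"
    "\<And>a b. index12 (m + a) (n + b) = index12 (i + k + a) (i + b)"
    "\<And>a b. index12 (a - m) (b - n) = index12 (a - (i + k)) (b - i)"
proof
  let ?i = "n mod 2" and ?k = "(m - n) mod 6"
  show "?i \<in> {0, 1}" by auto
  show "?k \<in> {0, 1, 2, 3, 4, 5}"
    using pos_mod_bound[of 6 "m - n"] pos_mod_sign[of 6 "m - n"] by (simp; linarith)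
  have "even (n - ?i)" and "6 dvd ((m - n) - ?k)" by (rule dvd_minus_mod)+
  moreover have "m - (?i + ?k) - (n - ?i) = (m - n) - ?k"
    "?i + ?k - m - (?i - n) = - ((m - n) - ?k)" "?i - n = - (n - ?i)" by simp_all
  ultimately have "(m - (?i + ?k), n - ?i) \<in> {(a, b). even b \<and> 6 dvd (a - b)}"
    "(?i + ?k - m, ?i - n) \<in> {(a, b). even b \<and> 6 dvd (a - b)}"
    by (simp_all only: mem_Collect_eq prod.case dvd_minus_iff simp_thms)
  then show "index12 (m + a) (n + b) = index12 (?i + ?k + a) (?i + b)"
    "index12 (a - m) (b - n) = index12 (a - (?i + ?k)) (b - ?i)" for a b
    unfolding index12_eq_iff by (simp_all only: add_diff_cancel_right diff_diff_eq2 diff_add_eq) (simp_all add: algebra_simps)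
qed

text \<open>The four hexagons centred at fixed points of half-turns become triangles, whose labels are the
  corners sharing their first argument; the second argument names the triangle at the far end of
  the remaining edge.\<close>

definition table_T :: "'a::real_vector \<Rightarrow> 'a \<Rightarrow> 'a \<Rightarrow> 'a \<Rightarrow> 'a list" where
  "table_T a b c d =
    [corner a b, corner a d, corner d b, corner c d, corner c b, corner b d,
     corner b a, corner b c, corner c a, corner d c, corner d a, corner a c]"

lemma T_iso:
  "digraph_iso (with_proj truncated_tetrahedron_graph)
     (with_proj (quotient_graph G_T (natural_action honeycomb) honeycomb))"
proof -
  \<comment> \<open>Naming the four vertices keeps their coordinates out of the case check; equality
    of corners is decided by \<open>corner_eq_iff\<close>.\<close>
  obtain a b c d where dist: "distinct [a, b, c, d]" and V: "tetrahedron_vertices = {a, b, c, d}"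
  proof
    show "distinct [(1, 1, 1), (1, -1, -1), (-1, 1, -1), (-1, -1, 1) :: real \<times> real \<times> real]" by simp
  qed (simp add: tetrahedron_vertices_def)
  show ?thesis
    unfolding G_T_def Lambda_X3_eq
  proof (rule index_lattice.half_turn_quotient[OF index_lattice_X3])
    let ?V = "{a, b, c, d}"
    let ?t = "table_T a b c d"
    let ?f = "\<lambda>m n. ?t ! index12 m n"
    have len: "length ?t = 12" by (simp add: table_T_def)
    have ne: "a \<noteq> b" "b \<noteq> a" "a \<noteq> c" "c \<noteq> a" "a \<noteq> d" "d \<noteq> a"
      "b \<noteq> c" "c \<noteq> b" "b \<noteq> d" "d \<noteq> b" "c \<noteq> d" "d \<noteq> c"
      using dist by auto
    note eq_iff = tetrahedron.corner_eq_iff[unfolded V]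
    have distinct: "distinct ?t"
      using ne unfolding table_T_def by (simp add: eq_iff)
    have corners: "corners ?V = set ?t"
    proof
      show "corners ?V \<subseteq> set ?t" using dist by (auto simp: corners_def table_T_def)
      show "set ?t \<subseteq> corners ?V" using dist by (auto simp: table_T_def intro!: cornersI)
    qed
    show "?f m n = ?f m' n' \<longleftrightarrow> (m - m', n - n') \<in> {(a, b). even b \<and> 6 dvd (a - b)}" for m n m' n'
      unfolding index12_eq_iff[symmetric]
      by (rule nth_eq_iff_index_eq[OF distinct]) (simp_all add: len index12_less)
    show "pverts truncated_tetrahedron_graph = range (\<lambda>(m, n). ?f m n)"
      by (simp add: truncated_tetrahedron_graph_eq V corners range_nth_index12[OF len])
    show "parcs truncated_tetrahedron_graph \<subseteq> pverts truncated_tetrahedron_graph \<times> pverts truncated_tetrahedron_graph"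
      by (auto simp: truncated_tetrahedron_graph_eq)
    note nbrs = truncated_tetrahedron_graph_neighbours[unfolded V]
    show "{y. (?f m n, y) \<in> parcs truncated_tetrahedron_graph} =
        {?f (- 1 - m) (- 1 - n), ?f (- 2 - m) (- 1 - n), ?f (- 1 - m) (- 2 - n)}" for m n
    proof -
      obtain i k :: int where i: "i \<in> {0, 1}" and k: "k \<in> {0, 1, 2, 3, 4, 5}"
        and plus: "\<And>a b. index12 (m + a) (n + b) = index12 (i + k + a) (i + b)"
        and minus: "\<And>a b. index12 (a - m) (b - n) = index12 (a - (i + k)) (b - i)"
        by (rule index12_reduce[of m n]) (rule that, assumption+)
      have mn: "index12 m n = index12 (i + k) i" using plus[of 0 0] by simp
      show ?thesis
        unfolding mn minus using i k ne
        by (elim insertE emptyE) (simp_all add: index12_def table_T_def nbrs insert_Diff_if insert_commute)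
    qed
  qed
qed

section \<open>One-line notation for permutations, and the star graph\<close>

definition perm4 :: "nat \<Rightarrow> nat \<Rightarrow> nat \<Rightarrow> nat \<Rightarrow> nat \<Rightarrow> nat" where
  "perm4 a b c d x = (if x = 1 then a else if x = 2 then b else if x = 3 then c else if x = 4 then d else x)"

lemma perm4_eq_iff: "perm4 a b c d = perm4 a' b' c' d' \<longleftrightarrow> a = a' \<and> b = b' \<and> c = c' \<and> d = d'"
proof
  assume eq: "perm4 a b c d = perm4 a' b' c' d'"
  show "a = a' \<and> b = b' \<and> c = c' \<and> d = d'"
    using fun_cong[OF eq, of 1] fun_cong[OF eq, of 2] fun_cong[OF eq, of 3] fun_cong[OF eq, of 4]
    by (simp add: perm4_def)
qed simp

lemma perm4_permutes:
  assumes "distinct [a, b, c, d]" "{a, b, c, d} \<subseteq> {1..4}"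
  shows "perm4 a b c d permutes {1..4}"
proof (rule bij_imp_permutes)
  have *: "{1..4::nat} = {1, 2, 3, 4}" by auto
  have inj: "inj_on (perm4 a b c d) {1..4}"
    unfolding * using assms(1) by (auto simp: inj_on_def perm4_def)
  moreover have "perm4 a b c d ` {1..4} \<subseteq> {1..4}"
    using assms(2) by (auto simp: perm4_def)
  ultimately have "perm4 a b c d ` {1..4} = {1..4}" by (intro endo_inj_surj) auto
  with inj show "bij_betw (perm4 a b c d) {1..4} {1..4}" by (rule bij_betw_imageI)
qed (auto simp: perm4_def)

text \<open>Multiplication on the right acts on positions: it exchanges the last entry with one of
  the first three.\<close>

lemma perm4_comp_transpose:
  "perm4 a b c d \<circ> Transposition.transpose 1 4 = perm4 d b c a"
  "perm4 a b c d \<circ> Transposition.transpose 2 4 = perm4 a d c b"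
  "perm4 a b c d \<circ> Transposition.transpose 3 4 = perm4 a b d c"
  by (auto simp: fun_eq_iff perm4_def Transposition.transpose_def)

lemma star_graph_X3_neighbours:
  assumes "distinct [a, b, c, d]" "{a, b, c, d} \<subseteq> {1..4}"
  shows "{y. (perm4 a b c d, y) \<in> parcs star_graph_X3} = {perm4 d b c a, perm4 a d c b, perm4 a b d c}"
proof -
  have "perm4 a b c d permutes {1..4}" "perm4 d b c a permutes {1..4}"
    "perm4 a d c b permutes {1..4}" "perm4 a b d c permutes {1..4}"
    by (rule perm4_permutes; use assms in auto)+
  then show ?thesis
    by (auto simp: star_graph_X3_def Cay_def sym_group_def perm4_comp_transpose simp del: One_nat_def)
qed

text \<open>Colour the edge from the black vertex \<open>(m, n)\<close> to the white vertices \<open>(m, n)\<close>, \<open>(m + 1, n)\<close>,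
  \<open>(m, n + 1)\<close> by \<open>j - m + n\<close> modulo 3 with \<open>j = 0, 1, 2\<close>, and let the colours 0, 1, 2 stand for
  the transpositions (1 4), (2 4), (3 4). Around a hexagon two colours alternate, so that the product
  of transpositions along a walk from the black vertex \<open>(0, 0)\<close> depends only on its endpoint; the
  tables list these products.\<close>

definition black_table_X3 :: "(nat \<Rightarrow> nat) list" where
  "black_table_X3 =
    [perm4 1 2 3 4, perm4 1 4 2 3, perm4 3 1 2 4, perm4 2 1 4 3, perm4 2 3 1 4, perm4 4 2 1 3,
     perm4 4 3 2 1, perm4 4 1 3 2, perm4 2 4 3 1, perm4 3 4 1 2, perm4 3 2 4 1, perm4 1 3 4 2]"

definition white_table_X3 :: "(nat \<Rightarrow> nat) list" where
  "white_table_X3 =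
    [perm4 4 2 3 1, perm4 1 4 3 2, perm4 3 4 2 1, perm4 3 1 4 2, perm4 2 3 4 1, perm4 4 3 1 2,
     perm4 1 3 2 4, perm4 4 1 2 3, perm4 2 1 3 4, perm4 2 4 1 3, perm4 3 2 1 4, perm4 1 2 4 3]"

lemma X3_iso:
  "digraph_iso (with_proj star_graph_X3)
     (with_proj (quotient_graph (translation_group Lambda_X3) (natural_action honeycomb) honeycomb))"
  unfolding Lambda_X3_eq
proof (rule index_lattice.translation_quotient[OF index_lattice_X3])
  let ?t = "\<lambda>c. if c then black_table_X3 else white_table_X3"
  let ?f = "\<lambda>c m n. ?t c ! index12 m n"
  have len: "length (?t c) = 12" for c by (simp add: black_table_X3_def white_table_X3_def)
  \<comment> \<open>Distinctness within a table separates the cosets, distinctness across the tables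
    separates the colours.\<close>
  have distinct: "distinct (black_table_X3 @ white_table_X3)"
    by (simp add: black_table_X3_def white_table_X3_def perm4_eq_iff)
  have f_in: "?f c m n \<in> set (?t c)" for c m n using len[of c] by (simp add: index12_less)
  show "?f c m n = ?f c' m' n' \<longleftrightarrow>
      c = c' \<and> (m - m', n - n') \<in> {(a, b). even b \<and> 6 dvd (a - b)}" for c m n c' m' n'
  proof (cases "c = c'")
    case True
    have "distinct (?t c)" using distinct by simp
    then have "?f c m n = ?f c m' n' \<longleftrightarrow> index12 m n = index12 m' n'"
      by (rule nth_eq_iff_index_eq) (simp_all only: len index12_less)
    then show ?thesis using True by (simp only: index12_eq_iff simp_thms)
  next
    case False
    then have "set (?t c) \<inter> set (?t c') = {}" using distinct by auto
    then show ?thesis using False f_in[of c m n] f_in[of c' m' n'] by auto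
  qed
  have range_bool: "range (\<lambda>(m, n). g True m n) \<union> range (\<lambda>(m, n). g False m n) =
      range (\<lambda>(c, m, n). g c m n)" for g :: "bool \<Rightarrow> int \<Rightarrow> int \<Rightarrow> 'z"
    by (simp add: set_eq_iff image_iff ex_bool_eq)
  \<comment> \<open>The tables hold 24 distinct permutations, as many as 4!, so counting shows that
    every permutation occurs.\<close>
  have "set (black_table_X3 @ white_table_X3) \<subseteq> {p. p permutes {1..4}}"
    by (simp add: black_table_X3_def white_table_X3_def perm4_permutes[simplified])
  moreover have "card {p. p permutes {1..4::nat}} = card (set (black_table_X3 @ white_table_X3))"
    unfolding distinct_card[OF distinct]
    by (simp add: card_permutations[of _ 4] black_table_X3_def white_table_X3_def fact_numeral)
  ultimately have "{p. p permutes {1..4::nat}} = set (black_table_X3 @ white_table_X3)"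
    by (intro card_subset_eq[symmetric]) (simp_all add: finite_permutations)
  then have "pverts star_graph_X3 = set (?t True) \<union> set (?t False)"
    by (simp add: star_graph_X3_def Cay_def sym_group_def)
  also have "\<dots> = range (\<lambda>(m, n). ?f True m n) \<union> range (\<lambda>(m, n). ?f False m n)"
    by (simp only: range_nth_index12[OF len])
  also have "\<dots> = range (\<lambda>(c, m, n). ?f c m n)"
    by (rule range_bool)
  finally show "pverts star_graph_X3 = range (\<lambda>(c, m, n). ?f c m n)" .
  show "parcs star_graph_X3 \<subseteq> pverts star_graph_X3 \<times> pverts star_graph_X3"
    by (auto simp: star_graph_X3_def Cay_def)
  fix m n :: int
  obtain i k :: int where i: "i \<in> {0, 1}" and k: "k \<in> {0, 1, 2, 3, 4, 5}"
    and plus: "\<And>a b. index12 (m + a) (n + b) = index12 (i + k + a) (i + b)"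
    by (rule index12_reduce[of m n]) (rule that, assumption+)
  have mn: "index12 m n = index12 (i + k) i"
    "index12 (m + 1) n = index12 (i + k + 1) i" "index12 m (n + 1) = index12 (i + k) (i + 1)"
    "index12 (m - 1) n = index12 (i + k - 1) i" "index12 m (n - 1) = index12 (i + k) (i - 1)"
    using plus[of 0 0] plus[of 1 0] plus[of 0 1] plus[of "- 1" 0] plus[of 0 "- 1"] by simp_all
  show "{y. (?f True m n, y) \<in> parcs star_graph_X3} =
      {?f False m n, ?f False (m + 1) n, ?f False m (n + 1)}"
    unfolding mn using i k
    by (elim insertE emptyE) (simp_all add: index12_def black_table_X3_def white_table_X3_def
      star_graph_X3_neighbours insert_commute)
  show "{y. (?f False m n, y) \<in> parcs star_graph_X3} =
      {?f True m n, ?f True (m - 1) n, ?f True m (n - 1)}"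
    unfolding mn using i k
    by (elim insertE emptyE) (simp_all add: index12_def black_table_X3_def white_table_X3_def
      star_graph_X3_neighbours insert_commute)
qed

theorem proposition2:
  shows "acts_by_automorphisms G_K4 (natural_action honeycomb) honeycomb \<and>
         acts_by_automorphisms (translation_group Lambda_Q) (natural_action honeycomb) honeycomb \<and>
         acts_by_automorphisms G_T (natural_action honeycomb) honeycomb \<and>
         acts_by_automorphisms (translation_group Lambda_X3) (natural_action honeycomb) honeycomb \<and>
         digraph_iso (with_proj (complete_graph 4))
           (with_proj (quotient_graph G_K4 (natural_action honeycomb) honeycomb)) \<and>
         digraph_iso (with_proj cube_graph)
           (with_proj (quotient_graph (translation_group Lambda_Q) (natural_action honeycomb) honeycomb)) \<and>
         digraph_iso (with_proj truncated_tetrahedron_graph)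
           (with_proj (quotient_graph G_T (natural_action honeycomb) honeycomb)) \<and>
         digraph_iso (with_proj star_graph_X3)
           (with_proj (quotient_graph (translation_group Lambda_X3) (natural_action honeycomb) honeycomb))"
proof (intro conjI)
  note Q = index_lattice_Q and X3 = index_lattice_X3
  show "acts_by_automorphisms G_K4 (natural_action honeycomb) honeycomb"
    unfolding G_K4_def Lambda_Q_eq by (rule index_lattice.half_turn_group_acts[OF Q])
  show "acts_by_automorphisms (translation_group Lambda_Q) (natural_action honeycomb) honeycomb"
    unfolding Lambda_Q_eq by (rule index_lattice.translation_group_acts[OF Q])
  show "acts_by_automorphisms G_T (natural_action honeycomb) honeycomb"
    unfolding G_T_def Lambda_X3_eq by (rule index_lattice.half_turn_group_acts[OF X3])
  show "acts_by_automorphisms (translation_group Lambda_X3) (natural_action honeycomb) honeycomb"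
    unfolding Lambda_X3_eq by (rule index_lattice.translation_group_acts[OF X3])
qed (fact K4_iso Q_iso T_iso X3_iso)+

end
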